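(* Let $\mathfrak O$ be a compact discrete valuation ring with residue field of cardinality $q$. Let $d,e\ge1$, let $\mathcal A$ be a partial colouring of $[d]\times[e]$, and let $u\in \mathrm M_{d\times e}(\mathfrak O)$ have unit entries. If $\mathcal A$ is admissible, then $$\mathsf Z^{\mathsf{ask}}_{\mathrm{ARel}_{d\times e}(\mathcal A,u,\mathfrak O)}(T)=\frac{1-q^{1-d-e}T}{(1-T)(1-qT)}.$$
   Context: All rings are commutative and unital. $\mathfrak O$ has maximal ideal $\mathfrak P$. Write $[d]=\{1,\dots,d\}$. Ask zeta functions. For a module $A\subset \mathrm M_{d\times e}(S)$ of matrices over a finite ring $S$, let $\mathrm{ask}(A)=\frac1{|A|}\sum_{a\in A}|\mathrm{Ker}(a)|$, where $d\times e$ matrices act by right multiplication on row vectors, i.e. $\mathrm{Ker}(a)=\{x\in S^d: xa=0\}$. For a submodule $M\subset \mathrm M_{d\times e}(\mathfrak O)$, let $M_n$ be its image in $\mathrm M_{d\times e}(\mathfrak O/\mathfrak P^n)$ and $\mathsf Z^{\mathsf{ask}}_M(T)=\sum_{n=0}^\infty \mathrm{ask}(M_n)T^n\in\mathbf Q[[T]]$. Partial colourings. Let $\mathcal C$ be a set (of colours). A partial colouring of $[d]\times[e]$ is a family $\mathcal A=(A_c)_{c\in\mathcal C}$ of pairwise disjoint (possibly empty) subsets of $[d]\times[e]$. A cell $(i,j)\in [d]\times[e]$ is blank if it belongs to no $A_c$. A subgrid is a set $G=I\times J$ with $I\subset[d]$, $J\subset[e]$; it is colour-closed if $A_c\subset G$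 for every $c\in\mathcal C$ with $A_c\cap G\ne\emptyset$. $\mathcal A$ is admissible if every non-empty colour-closed subgrid of $[d]\times[e]$ contains a blank cell. Relation modules. $\mathrm{Rel}_{d\times e}(\mathcal A,u,\mathfrak O)=\{[x_{ij}]\in \mathrm M_{d\times e}(\mathfrak O): \sum_{(i,j)\in A_c}u_{ij}x_{ij}=0 \text{ for all } c\in\mathcal C\}$ and $\mathrm{ARel}_{d\times e}(\mathcal A,u,\mathfrak O)=\left\{\begin{bmatrix}a&x\\-x^\top&b\end{bmatrix}: a\in\mathrm{Alt}_d(\mathfrak O), b\in\mathrm{Alt}_e(\mathfrak O), x\in\mathrm{Rel}_{d\times e}(\mathcal A,u,\mathfrak O)\right\}\subset \mathrm M_{(d+e)\times(d+e)}(\mathfrak O)$, where $\mathrm{Alt}_d(\mathfrak O)$ is the module of alternating (antisymmetric with zero diagonal) $d\times d$ matrices. *)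

theory Defs
  imports
    "HOL-Analysis.Function_Topology"
    "HOL-Algebra.Ring_Divisibility"
    "HOL-Algebra.Ideal_Product"
    "HOL-Computational_Algebra.Formal_Power_Series"
    "Jordan_Normal_Form.Matrix"
begin

text \<open>
  Ideal powers are powers in the library's monoid \<^const>\<open>ideals_set\<close>, so the zeroth power is
  the whole ring. The cosets of the powers of \<open>I\<close> form a base of the \<open>I\<close>-adic topology.
\<close>

definition adic_topology :: "('a, 'b) ring_scheme \<Rightarrow> 'a set \<Rightarrow> 'a topology" where
  "adic_topology R I =
     topology_generated_by (\<Union>n::nat. a_rcosets\<^bsub>R\<^esub> (I [^]\<^bsub>ideals_set R\<^esub> n))"

locale discrete_valuation_ring = principal_domain R for R (structure) +
  fixes P :: "'a set"
  assumes not_field: "\<not> field R"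
    and maximalideal_P: "maximalideal P R"
    and unique_maximalideal: "maximalideal J R \<Longrightarrow> J = P"

locale compact_discrete_valuation_ring = discrete_valuation_ring +
  assumes compact: "compact_space (adic_topology R P)"

text \<open>
  The type of matrices carries no algebraic structure here: all ring operations are those of the
  record \<open>R\<close>. Rows and columns are indexed from 0, so that \<open>[d]\<close> becomes \<open>{..<d}\<close>.
\<close>

definition mats :: "('a, 'b) ring_scheme \<Rightarrow> nat \<Rightarrow> nat \<Rightarrow> 'a mat set" where
  "mats R d e = {a \<in> carrier_mat d e. elements_mat a \<subseteq> carrier R}"

definition row_kernel :: "('a, 'b) ring_scheme \<Rightarrow> 'a mat \<Rightarrow> 'a vec set" where
  "row_kernel S a =
     {x \<in> carrier_vec (dim_row a). set\<^sub>v x \<subseteq> carrier S \<and>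
        (\<forall>j<dim_col a. (\<Oplus>\<^bsub>S\<^esub>i\<in>{..<dim_row a}. x $ i \<otimes>\<^bsub>S\<^esub> a $$ (i, j)) = \<zero>\<^bsub>S\<^esub>)}"

definition ask :: "('a, 'b) ring_scheme \<Rightarrow> 'a mat set \<Rightarrow> rat" where
  "ask S A = (\<Sum>a\<in>A. of_nat (card (row_kernel S a))) / of_nat (card A)"

definition reduce_mats :: "('a, 'b) ring_scheme \<Rightarrow> 'a set \<Rightarrow> 'a mat set \<Rightarrow> 'a set mat set" where
  "reduce_mats R I M = map_mat (\<lambda>r. I +>\<^bsub>R\<^esub> r) ` M"

definition ask_zeta :: "('a, 'b) ring_scheme \<Rightarrow> 'a set \<Rightarrow> 'a mat set \<Rightarrow> rat fps" where
  "ask_zeta R P M =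
     Abs_fps (\<lambda>n. let I = P [^]\<^bsub>ideals_set R\<^esub> n in ask (R Quot I) (reduce_mats R I M))"

definition partial_colouring :: "nat \<Rightarrow> nat \<Rightarrow> 'c set \<Rightarrow> ('c \<Rightarrow> (nat \<times> nat) set) \<Rightarrow> bool" where
  "partial_colouring d e C A \<longleftrightarrow>
     (\<forall>c\<in>C. A c \<subseteq> {..<d} \<times> {..<e}) \<and> disjoint_family_on A C"

definition blank :: "'c set \<Rightarrow> ('c \<Rightarrow> (nat \<times> nat) set) \<Rightarrow> nat \<times> nat \<Rightarrow> bool" where
  "blank C A p \<longleftrightarrow> (\<forall>c\<in>C. p \<notin> A c)"

definition subgrid :: "nat \<Rightarrow> nat \<Rightarrow> (nat \<times> nat) set \<Rightarrow> bool" where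
  "subgrid d e G \<longleftrightarrow> (\<exists>I J. I \<subseteq> {..<d} \<and> J \<subseteq> {..<e} \<and> G = I \<times> J)"

definition colour_closed :: "'c set \<Rightarrow> ('c \<Rightarrow> (nat \<times> nat) set) \<Rightarrow> (nat \<times> nat) set \<Rightarrow> bool" where
  "colour_closed C A G \<longleftrightarrow> (\<forall>c\<in>C. A c \<inter> G \<noteq> {} \<longrightarrow> A c \<subseteq> G)"

definition admissible :: "nat \<Rightarrow> nat \<Rightarrow> 'c set \<Rightarrow> ('c \<Rightarrow> (nat \<times> nat) set) \<Rightarrow> bool" where
  "admissible d e C A \<longleftrightarrow>
     (\<forall>G. subgrid d e G \<and> G \<noteq> {} \<and> colour_closed C A G \<longrightarrow> (\<exists>p\<in>G. blank C A p))"

definition Alt :: "('a, 'b) ring_scheme \<Rightarrow> nat \<Rightarrow> 'a mat set" where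
  "Alt R d =
     {a \<in> mats R d d. (\<forall>i<d. a $$ (i, i) = \<zero>\<^bsub>R\<^esub>) \<and>
        (\<forall>i<d. \<forall>j<d. a $$ (j, i) = \<ominus>\<^bsub>R\<^esub> a $$ (i, j))}"

definition Rel :: "('a, 'b) ring_scheme \<Rightarrow> nat \<Rightarrow> nat \<Rightarrow> 'c set \<Rightarrow> ('c \<Rightarrow> (nat \<times> nat) set) \<Rightarrow>
    'a mat \<Rightarrow> 'a mat set" where
  "Rel R d e C A u =
     {x \<in> mats R d e. \<forall>c\<in>C. (\<Oplus>\<^bsub>R\<^esub>p\<in>A c. u $$ p \<otimes>\<^bsub>R\<^esub> x $$ p) = \<zero>\<^bsub>R\<^esub>}"

definition ARel :: "('a, 'b) ring_scheme \<Rightarrow> nat \<Rightarrow> nat \<Rightarrow> 'c set \<Rightarrow> ('c \<Rightarrow> (nat \<times> nat) set) \<Rightarrow>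
    'a mat \<Rightarrow> 'a mat set" where
  "ARel R d e C A u =
     {four_block_mat a x (map_mat (a_inv R) (transpose_mat x)) b | a b x.
        a \<in> Alt R d \<and> b \<in> Alt R e \<and> x \<in> Rel R d e C A u}"

end

theory Submission
  imports Defs
begin

text \<open>
  Write \<open>S\<close> for the quotient by the \<open>n\<close>-th power of the maximal ideal \<open>(\<pi>)\<close> and \<open>N = d + e\<close>.
  Counting pairs \<open>(a, x)\<close> with \<open>x a = 0\<close> in two ways gives \<open>ask M = (\<Sum>x. 1 / card (x M))\<close>. Write
  \<open>x = \<pi>^k y\<close> with a unit coordinate \<open>y i0\<close>. Since \<open>M\<close> is alternating, \<open>y M\<close> lies in the orthogonal
  complement of \<open>y\<close>, and the point is that it is all of it, as for the full module of alternating
  matrices: then \<open>card (x M) = card (\<pi>^k S) ^ (N - 1)\<close>, which does not depend on the colouring.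

  The complement is spanned by the vectors \<open>g i j = y i e j - y j e i\<close>, so these must lie in
  \<open>y M\<close>. Only row indices \<open>i\<close> paired with column indices \<open>j\<close> are in question. One shows
  \<open>\<pi>^k g i j \<in> y M\<close> by descending induction on \<open>k\<close>: the cells \<open>(i, j)\<close> where this fails form, by
  the three-term relations between the \<open>g i j\<close>, a subgrid; it is colour-closed because \<open>u\<close> has unit
  entries, and it contains no blank cell, so it is empty by admissibility.
\<close>

subsection \<open>Wedges of a vector with a unit coordinate\<close>

lemma card_eq_card_fibre_times_card_image:
  assumes "finite A" and "\<And>b. b \<in> A \<Longrightarrow> card {a \<in> A. f a = f b} = k"
  shows "card A = k * card (f ` A)"
proof -
  have "card A = (\<Sum>y\<in>f ` A. card {a \<in> A. f a = y})"
    using sum.group[of A "f ` A" f "\<lambda>_. 1::nat"] assms(1) by simp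
  also have "\<dots> = (\<Sum>y\<in>f ` A. k)"
    using assms(2) by (intro sum.cong) auto
  finally show ?thesis by simp
qed

text \<open>Each image is a copy of the quotient of \<open>A\<close> by the relation of lying in a
  common fibre, and the two relations agree. It serves to compare the multiples of
  \<open>\<pi> [^] k\<close> in one residue ring with a whole smaller residue ring.\<close>

lemma card_image_eq_if_same_fibres:
  assumes "\<And>x y. x \<in> A \<Longrightarrow> y \<in> A \<Longrightarrow> f x = f y \<longleftrightarrow> g x = g y"
  shows "card (f ` A) = card (g ` A)"
proof -
  have "bij_betw (\<lambda>z. g (inv_into A f z)) (f ` A) (g ` A)"
  proof (rule bij_betw_imageI)
    have *: "g (inv_into A f (f x)) = g x" if "x \<in> A" for x
      using assms[of "inv_into A f (f x)" x] that
      by (simp add: inv_into_into f_inv_into_f)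
    show "inj_on (\<lambda>z. g (inv_into A f z)) (f ` A)"
      using * assms by (auto intro!: inj_onI)
    show "(\<lambda>z. g (inv_into A f z)) ` f ` A = g ` A"
      using * by (force simp: image_iff)
  qed
  then show ?thesis by (rule bij_betw_same_card)
qed

text \<open>The vector x_i e_j - x_j e_i, which is orthogonal to x and arises by applying the
  elementary alternating matrix \<open>alt_unit\<close> to x. Vectors are total functions, so that
  identities between wedges need no bounds on indices.\<close>

definition (in ring) wedge :: "(nat \<Rightarrow> 'a) \<Rightarrow> nat \<Rightarrow> nat \<Rightarrow> nat \<Rightarrow> 'a" where
  "wedge x i j l = (if l = j then x i else \<zero>) \<ominus> (if l = i then x j else \<zero>)"

section \<open>Submodules of functions and the wedges in them\<close>

locale function_submodule = cring R for R (structure) +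
  fixes W :: "(nat \<Rightarrow> 'a) set"
  assumes W_carrier: "v \<in> W \<Longrightarrow> v l \<in> carrier R"
    and W_zero: "(\<lambda>_. \<zero>) \<in> W"
    and W_add: "v \<in> W \<Longrightarrow> w \<in> W \<Longrightarrow> (\<lambda>l. v l \<oplus> w l) \<in> W"
    and W_smult: "s \<in> carrier R \<Longrightarrow> v \<in> W \<Longrightarrow> (\<lambda>l. s \<otimes> v l) \<in> W"
begin

lemma W_diff:
  assumes "v \<in> W" "w \<in> W"
  shows "(\<lambda>l. v l \<ominus> w l) \<in> W"
proof -
  have "(\<lambda>l. v l \<oplus> \<ominus> \<one> \<otimes> w l) \<in> W"
    using assms by (intro W_add W_smult) auto
  moreover have "(\<lambda>l. v l \<oplus> \<ominus> \<one> \<otimes> w l) = (\<lambda>l. v l \<ominus> w l)"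
    using W_carrier[OF assms(2)] by (auto simp: a_minus_def l_minus)
  ultimately show ?thesis by simp
qed

lemma W_sum:
  assumes "finite F" "\<And>j. j \<in> F \<Longrightarrow> f j \<in> W"
  shows "(\<lambda>l. \<Oplus>j\<in>F. f j l) \<in> W"
  using assms
proof (induction F)
  case empty
  then show ?case by (simp add: W_zero)
next
  case (insert i F)
  have "(\<lambda>l. \<Oplus>j\<in>insert i F. f j l) = (\<lambda>l. f i l \<oplus> (\<Oplus>j\<in>F. f j l))"
    using insert by (auto intro!: ext finsum_insert simp: W_carrier)
  then show ?case using insert by (simp add: W_add)
qed

lemma W_unit_smult_iff:
  assumes "s \<in> Units R" "\<And>l. v l \<in> carrier R"
  shows "(\<lambda>l. s \<otimes> v l) \<in> W \<longleftrightarrow> v \<in> W"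
proof
  assume "(\<lambda>l. s \<otimes> v l) \<in> W"
  then have "(\<lambda>l. inv s \<otimes> (s \<otimes> v l)) \<in> W"
    using W_smult[of "inv s" "\<lambda>l. s \<otimes> v l"] assms by auto
  moreover have "(\<lambda>l. inv s \<otimes> (s \<otimes> v l)) = v"
    using assms by (auto simp: m_assoc[symmetric] Units_closed)
  ultimately show "v \<in> W" by simp
qed (use assms in \<open>auto intro: W_smult\<close>)

end

text \<open>Indices below \<open>d\<close> stand for the rows of the grid, the others for its
  columns. Wedges within one block come for free from the diagonal blocks of \<open>ARel\<close>. In
  the application \<open>W\<close> consists of the functions that agree below \<open>N\<close> with
  a vector of the module x M.\<close>

locale wedge_submodule = function_submodule +
  fixes \<pi> :: 'a and d N :: nat and x :: "nat \<Rightarrow> 'a"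
  assumes \<pi>_closed: "\<pi> \<in> carrier R"
    and unit_or_divisible: "s \<in> carrier R \<Longrightarrow> s \<notin> Units R \<Longrightarrow> \<exists>t\<in>carrier R. s = \<pi> \<otimes> t"
    and x_closed: "x i \<in> carrier R"
    and unit_coordinate: "\<exists>i<N. x i \<in> Units R"
    and same_block: "i < N \<Longrightarrow> j < N \<Longrightarrow> i < d \<longleftrightarrow> j < d \<Longrightarrow> wedge x i j \<in> W"
begin

lemma wedge_closed [simp]: "wedge x i j l \<in> carrier R"
  by (simp add: wedge_def x_closed)

text \<open>
  The three-term relation among three indices, one of whose wedges is already known to be in \<open>W\<close>.
\<close>

lemma wedge_row_exchange:
  assumes "i < N" "i' < N" "i < d \<longleftrightarrow> i' < d" "t \<in> carrier R"
    and "(\<lambda>l. t \<otimes> (x i' \<otimes> wedge x i j l)) \<in> W"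
  shows "(\<lambda>l. t \<otimes> (x i \<otimes> wedge x i' j l)) \<in> W"
proof -
  have "x i \<otimes> wedge x i' j l = x i' \<otimes> wedge x i j l \<oplus> x j \<otimes> wedge x i' i l" for l
    using x_closed[of i] x_closed[of i'] x_closed[of j] unfolding wedge_def
    by (cases "l = i"; cases "l = i'"; cases "l = j"; simp; algebra)
  then have "(\<lambda>l. t \<otimes> (x i \<otimes> wedge x i' j l)) =
      (\<lambda>l. t \<otimes> (x i' \<otimes> wedge x i j l) \<oplus> (t \<otimes> x j) \<otimes> wedge x i' i l)"
    using assms(4) x_closed by (auto simp: r_distr m_assoc)
  then show ?thesis using assms x_closed by (auto intro!: W_add W_smult same_block)
qed

text \<open>The column version uses x_j g(i,j') = x_j' g(i,j) + x_i g(j,j'), whose last wedge lies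
  within a single block.\<close>

lemma wedge_column_exchange:
  assumes "j < N" "j' < N" "j < d \<longleftrightarrow> j' < d" "t \<in> carrier R"
    and "(\<lambda>l. t \<otimes> (x j' \<otimes> wedge x i j l)) \<in> W"
  shows "(\<lambda>l. t \<otimes> (x j \<otimes> wedge x i j' l)) \<in> W"
proof -
  have "x j \<otimes> wedge x i j' l = x j' \<otimes> wedge x i j l \<oplus> x i \<otimes> wedge x j j' l" for l
    using x_closed[of i] x_closed[of j'] x_closed[of j] unfolding wedge_def
    by (cases "l = i"; cases "l = j'"; cases "l = j"; simp; algebra)
  then have "(\<lambda>l. t \<otimes> (x j \<otimes> wedge x i j' l)) =
      (\<lambda>l. t \<otimes> (x j' \<otimes> wedge x i j l) \<oplus> (t \<otimes> x i) \<otimes> wedge x j j' l)"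
    using assms(4) x_closed by (auto simp: r_distr m_assoc)
  then show ?thesis using assms x_closed by (auto intro!: W_add W_smult same_block)
qed

text \<open>If the pivot \<open>i0\<close> is a row index and x_i = \<pi> t, then c x_i g(i0,j) = t
  (c \<pi>) g(i0,j) lies in \<open>W\<close> by the hypothesis one power higher. Exchanging rows
  puts c x_i0 g(i,j) into \<open>W\<close>, and the unit x_i0 cancels, so the cell is not bad. A
  pivot among the columns is treated symmetrically.\<close>

lemma bad_cells_unit:
  assumes "i < d" "d \<le> j" "j < N" "d \<le> N" "c \<in> carrier R"
    and bad: "(\<lambda>l. c \<otimes> wedge x i j l) \<notin> W"
    and IH: "\<And>i j. i < d \<Longrightarrow> d \<le> j \<Longrightarrow> j < N \<Longrightarrow> (\<lambda>l. (c \<otimes> \<pi>) \<otimes> wedge x i j l) \<in> W"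
    and i0: "i0 < N" "x i0 \<in> Units R"
  shows "if i0 < d then x i \<in> Units R else x j \<in> Units R"
proof (rule ccontr)
  define k where "k = (if i0 < d then i else j)"
  assume "\<not> ?thesis"
  then have "x k \<notin> Units R" by (auto simp: k_def split: if_splits)
  then obtain t where t: "t \<in> carrier R" "x k = \<pi> \<otimes> t"
    using unit_or_divisible x_closed by blast
  have c: "c \<otimes> (x k \<otimes> w) = t \<otimes> ((c \<otimes> \<pi>) \<otimes> w)" if "w \<in> carrier R" for w
    using t that assms(5) \<pi>_closed by (simp add: m_ac)
  have "(\<lambda>l. c \<otimes> (x i0 \<otimes> wedge x i j l)) \<in> W"
  proof (cases "i0 < d")
    case True
    have "(\<lambda>l. c \<otimes> (x i \<otimes> wedge x i0 j l)) \<in> W"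
      using W_smult[OF t(1) IH[OF True assms(2,3)]] True c by (simp add: k_def)
    then show ?thesis using True assms by (intro wedge_row_exchange[of i0 i]) auto
  next
    case False
    have "(\<lambda>l. c \<otimes> (x j \<otimes> wedge x i i0 l)) \<in> W"
      using W_smult[OF t(1) IH[OF assms(1) _ i0(1)]] False c by (simp add: k_def)
    then show ?thesis using False assms by (intro wedge_column_exchange[of i0 j]) auto
  qed
  moreover have "(\<lambda>l. c \<otimes> (x i0 \<otimes> wedge x i j l)) = (\<lambda>l. x i0 \<otimes> (c \<otimes> wedge x i j l))"
    using x_closed assms(5) by (simp add: m_ac)
  ultimately show False
    using W_unit_smult_iff[OF i0(2), of "\<lambda>l. c \<otimes> wedge x i j l"] bad assms(5) by simp
qed

text \<open>This makes the bad cells a product set. With a row pivot, x_i is a unit because (i,j) is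
  bad; were (i,j') good, exchanging i for i' and cancelling x_i would make (i',j') good. With a
  column pivot, x_j' is a unit because (i',j') is bad, and exchanging columns in row i would make
  (i,j) good.\<close>

lemma bad_cells_rectangle:
  assumes c: "c \<in> carrier R" and dN: "d \<le> N"
    and IH: "\<And>i j. i < d \<Longrightarrow> d \<le> j \<Longrightarrow> j < N \<Longrightarrow> (\<lambda>l. (c \<otimes> \<pi>) \<otimes> wedge x i j l) \<in> W"
    and ij: "i < d" "d \<le> j" "j < N" "(\<lambda>l. c \<otimes> wedge x i j l) \<notin> W"
    and ij': "i' < d" "d \<le> j'" "j' < N" "(\<lambda>l. c \<otimes> wedge x i' j' l) \<notin> W"
  shows "(\<lambda>l. c \<otimes> wedge x i j' l) \<notin> W"
proof
  assume "(\<lambda>l. c \<otimes> wedge x i j' l) \<in> W"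
  then have *: "(\<lambda>l. c \<otimes> (x k \<otimes> wedge x i j' l)) \<in> W" for k
    using W_smult[of "x k" "\<lambda>l. c \<otimes> wedge x i j' l"] x_closed[of k] c by (simp add: m_ac)
  have cancel: "(\<lambda>l. c \<otimes> wedge x r s l) \<in> W"
    if "x k \<in> Units R" "(\<lambda>l. c \<otimes> (x k \<otimes> wedge x r s l)) \<in> W" for k r s
    using W_unit_smult_iff[OF that(1), of "\<lambda>l. c \<otimes> wedge x r s l"] that(2) c x_closed
    by (simp add: m_ac)
  obtain i0 where i0: "i0 < N" "x i0 \<in> Units R" using unit_coordinate by blast
  show False
  proof (cases "i0 < d")
    case True
    have "x i \<in> Units R" using bad_cells_unit[OF ij(1-3) dN c ij(4) IH i0] True by simp
    moreover have "(\<lambda>l. c \<otimes> (x i \<otimes> wedge x i' j' l)) \<in> W"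
      using ij ij' dN c * by (intro wedge_row_exchange[of i i']) auto
    ultimately show False using cancel ij'(4) by blast
  next
    case False
    have "x j' \<in> Units R" using bad_cells_unit[OF ij'(1-3) dN c ij'(4) IH i0] False by simp
    moreover have "(\<lambda>l. c \<otimes> (x j' \<otimes> wedge x i j l)) \<in> W"
      using ij ij' dN c * by (intro wedge_column_exchange[of j' j]) auto
    ultimately show False using cancel ij(4) by blast
  qed
qed

end

text \<open>The cell \<open>(i, j)\<close> of the grid corresponds to the pair of indices \<open>(i, d + j)\<close>.\<close>

locale admissible_wedge_submodule = wedge_submodule R W \<pi> d N x
  for R (structure) and W \<pi> d N x +
  fixes e n :: nat and C :: "'c set" and A :: "'c \<Rightarrow> (nat \<times> nat) set" and u :: "nat \<times> nat \<Rightarrow> 'a"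
  assumes N_eq: "N = d + e"
    and nilpotent: "\<pi> [^] n = \<zero>"
    and colouring: "partial_colouring d e C A"
    and admissible: "admissible d e C A"
    and u_unit: "p \<in> {..<d} \<times> {..<e} \<Longrightarrow> u p \<in> Units R"
    and blank_wedge: "i < d \<Longrightarrow> j < e \<Longrightarrow> blank C A (i, j) \<Longrightarrow> wedge x i (d + j) \<in> W"
    and colour_wedge: "c \<in> C \<Longrightarrow> (i, j) \<in> A c \<Longrightarrow> (i', j') \<in> A c \<Longrightarrow>
      (\<lambda>l. u (i', j') \<otimes> wedge x i (d + j) l \<ominus> u (i, j) \<otimes> wedge x i' (d + j') l) \<in> W"
begin

text \<open>The descent from c \<pi> to c: the bad cells for c form a colour-closed subgrid without
  blank cells, so admissibility leaves none.\<close>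

lemma cross_wedge_descent:
  assumes c: "c \<in> carrier R"
    and IH: "\<And>i j. i < d \<Longrightarrow> d \<le> j \<Longrightarrow> j < N \<Longrightarrow> (\<lambda>l. (c \<otimes> \<pi>) \<otimes> wedge x i j l) \<in> W"
    and ij: "i < d" "d \<le> j" "j < N"
  shows "(\<lambda>l. c \<otimes> wedge x i j l) \<in> W"
proof (rule ccontr)
  define B where
    "B = {(i, j). i < d \<and> j < e \<and> (\<lambda>l. c \<otimes> wedge x i (d + j) l) \<notin> W}"
  assume "(\<lambda>l. c \<otimes> wedge x i j l) \<notin> W"
  then have "(i, j - d) \<in> B" using ij by (auto simp: B_def N_eq)
  then have nonempty: "B \<noteq> {}" by blast
  \<comment> \<open>The projections of \<open>B\<close> supply one bad cell in the given row and one
    in the given column; \<open>bad_cells_rectangle\<close> makes the crossing bad too.\<close>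
  have "B = fst ` B \<times> snd ` B"
  proof (intro equalityI subsetI)
    fix p assume "p \<in> fst ` B \<times> snd ` B"
    then obtain i j i' j' where p: "p = (i, j')" "(i, j) \<in> B" "(i', j') \<in> B" by auto
    then show "p \<in> B"
      using bad_cells_rectangle[OF c _ IH, of i "d + j" i' "d + j'"] by (auto simp: B_def N_eq)
  qed force
  then have "subgrid d e B"
    unfolding subgrid_def by (intro exI[of _ "fst ` B"] exI[of _ "snd ` B"]) (auto simp: B_def)
  moreover have "colour_closed C A B"
    unfolding colour_closed_def
  proof (intro ballI impI subsetI)
    fix b p' assume b: "b \<in> C" "A b \<inter> B \<noteq> {}" "p' \<in> A b"
    obtain i j i' j' where p: "(i, j) \<in> A b" "(i, j) \<in> B" "p' = (i', j')"
      using b(2) by (cases p') auto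
    have cells: "(i, j) \<in> {..<d} \<times> {..<e}" "(i', j') \<in> {..<d} \<times> {..<e}"
      using colouring b p unfolding partial_colouring_def by blast+
    show "p' \<in> B"
    proof (rule ccontr)
      let ?g = "\<lambda>l. c \<otimes> wedge x i (d + j) l" and ?g' = "\<lambda>l. c \<otimes> wedge x i' (d + j') l"
      assume "p' \<notin> B"
      then have g': "?g' \<in> W" using cells p by (auto simp: B_def)
      have U: "u (i, j) \<in> Units R" "u (i', j') \<in> Units R" using u_unit cells by auto
      \<comment> \<open>The colour relation times c, plus u(i,j) times the scaled wedge of the good
        cell (i',j'), leaves a unit multiple of the scaled wedge at the bad cell (i,j). Hence one
        good cell would make every cell of its colour good.\<close>
      have "(\<lambda>l. c \<otimes> (u (i', j') \<otimes> wedge x i (d + j) l \<ominus> u (i, j) \<otimes> wedge x i' (d + j') l)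
               \<oplus> u (i, j) \<otimes> ?g' l) \<in> W"
        using W_add[OF W_smult[OF c colour_wedge[OF b(1) p(1) b(3)[unfolded p(3)]]]
            W_smult[OF Units_closed[OF U(1)] g']] .
      moreover have "c \<otimes> (s \<otimes> v \<ominus> t \<otimes> w) \<oplus> t \<otimes> (c \<otimes> w) = s \<otimes> (c \<otimes> v)"
        if "s \<in> carrier R" "t \<in> carrier R" "v \<in> carrier R" "w \<in> carrier R" for s t v w
        using that c by algebra
      ultimately have "(\<lambda>l. u (i', j') \<otimes> ?g l) \<in> W"
        using U by (simp add: Units_closed)
      then show False
        using W_unit_smult_iff[OF U(2), of ?g] c p(2) by (simp add: B_def)
    qed
  qed
  ultimately obtain p where p: "p \<in> B" "blank C A p"
    using admissible nonempty unfolding admissible_def by blast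
  then obtain i j where "p = (i, j)" "i < d" "j < e" "(\<lambda>l. c \<otimes> wedge x i (d + j) l) \<notin> W"
    by (auto simp: B_def)
  \<comment> \<open>The wedge of a blank cell lies in \<open>W\<close> even before scaling by
    c.\<close>
  then show False using p(2) blank_wedge W_smult c by blast
qed

lemma wedge_mem:
  assumes "i < N" "j < N"
  shows "wedge x i j \<in> W"
proof -
  \<comment> \<open>The induction runs down from m = n, where the power of \<pi> vanishes and the
    claim is trivial, to m = 0, which is the wedge itself.\<close>
  have pow: "(\<lambda>l. \<pi> [^] m \<otimes> wedge x i j l) \<in> W"
    if "m \<le> n" "i < d" "d \<le> j" "j < N" for m i j
    using that
  proof (induction arbitrary: i j rule: inc_induct)
    case base
    then show ?case by (simp add: nilpotent W_zero)
  next
    case (step k)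
    have IH: "(\<lambda>l. (\<pi> [^] k \<otimes> \<pi>) \<otimes> wedge x i j l) \<in> W" if "i < d" "d \<le> j" "j < N" for i j
      using step.IH[OF that] by simp
    show ?case
      using IH step.prems by (rule cross_wedge_descent[OF nat_pow_closed[OF \<pi>_closed]])
  qed
  have cross: "wedge x i j \<in> W" if "i < d" "d \<le> j" "j < N" for i j
    using pow[OF _ that, of 0] by simp
  \<comment> \<open>Cross wedges were treated with the row index first; antisymmetry covers the
    other order.\<close>
  have swap: "wedge x i j = (\<lambda>l. \<zero> \<ominus> wedge x j i l)"
    using x_closed[of i] x_closed[of j] unfolding wedge_def
    by (intro ext; cases "l = i"; cases "l = j"; simp; algebra)
  show ?thesis
  proof (cases "i < d \<longleftrightarrow> j < d")
    case True
    then show ?thesis using assms same_block by blast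
  next
    case False
    then show ?thesis
      using assms cross[of i j] W_diff[OF W_zero cross[of j i]] swap by fastforce
  qed
qed

text \<open>Away from the pivot, g(i0,j) has the single nonzero coordinate x_i0, at j. Since x_i0 is
  a unit, scaled wedges g(i0,j) add up to any prescribed coordinates other than the one at
  \<open>i0\<close>.\<close>

lemma prescribed_coordinates_mem:
  assumes "i0 < N" "x i0 \<in> Units R" "r \<in> {..<N} - {i0} \<rightarrow> carrier R"
  shows "\<exists>v\<in>W. \<forall>j\<in>{..<N} - {i0}. v j = r j"
proof -
  let ?J = "{..<N} - {i0}"
  let ?f = "\<lambda>j l. (r j \<otimes> inv (x i0)) \<otimes> wedge x i0 j l"
  have "(\<Oplus>j\<in>?J. ?f j l) = r l" if l: "l \<in> ?J" for l
  proof -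
    have "?f j l = (if l = j then r j else \<zero>)" if "j \<in> ?J" for j
    proof -
      have "r j \<in> carrier R" using that assms(3) by auto
      then show ?thesis
        using l that assms(2) x_closed[of i0] by (auto simp: wedge_def m_assoc a_minus_def)
    qed
    then have "(\<Oplus>j\<in>?J. ?f j l) = (\<Oplus>j\<in>?J. if l = j then r j else \<zero>)"
      using assms by (intro finsum_cong') (auto simp: Pi_iff)
    also have "\<dots> = r l" using l assms by (intro finsum_singleton) auto
    finally show ?thesis .
  qed
  moreover have "(\<lambda>l. \<Oplus>j\<in>?J. ?f j l) \<in> W"
  proof (rule W_sum)
    fix j assume j: "j \<in> ?J"
    then have "r j \<in> carrier R" "j < N" using assms(3) by auto
    moreover have "inv (x i0) \<in> carrier R" using assms(2) by simp
    ultimately show "?f j \<in> W"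
      using W_smult[OF m_closed wedge_mem[OF assms(1)]] by blast
  qed simp
  ultimately show ?thesis
    by (intro bexI[of _ "\<lambda>l. \<Oplus>j\<in>?J. ?f j l"] ballI)
qed

end

subsection \<open>Alternating matrices acting on row vectors\<close>

text \<open>Off-diagonal entries cancel in pairs. Peeling off the last row and column avoids
  comparing the sum with its own negative, which would prove only that twice the sum
  vanishes.\<close>

lemma (in cring) alternating_sum_zero:
  fixes N :: nat
  assumes "\<And>i j. i < N \<Longrightarrow> j < N \<Longrightarrow> b i j \<in> carrier R"
    and "\<And>i. i < N \<Longrightarrow> b i i = \<zero>"
    and "\<And>i j. i < N \<Longrightarrow> j < N \<Longrightarrow> b j i = \<ominus> b i j"
  shows "(\<Oplus>j\<in>{..<N}. \<Oplus>i\<in>{..<N}. b i j) = \<zero>"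
  using assms
proof (induction N)
  case 0
  show ?case by simp
next
  case (Suc N)
  have ins: "(\<Oplus>i\<in>{..<Suc N}. f i) = f N \<oplus> (\<Oplus>i\<in>{..<N}. f i)"
    if "\<And>i. i \<le> N \<Longrightarrow> f i \<in> carrier R" for f
    using that by (simp add: lessThan_Suc Pi_iff)
  have closed: "b i j \<in> carrier R" if "i \<le> N" "j \<le> N" for i j
    using Suc.prems(1) that by simp
  have inner: "(\<Oplus>i\<in>{..<N}. b i j) \<in> carrier R" if "j \<le> N" for j
    using closed that by (auto intro!: finsum_closed)
  have IH: "(\<Oplus>j\<in>{..<N}. \<Oplus>i\<in>{..<N}. b i j) = \<zero>"
    by (rule Suc.IH) (blast intro: Suc.prems less_SucI)+
  have "(\<Oplus>j\<in>{..<Suc N}. \<Oplus>i\<in>{..<Suc N}. b i j)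
      = (\<Oplus>j\<in>{..<Suc N}. b N j \<oplus> (\<Oplus>i\<in>{..<N}. b i j))"
    using closed inner by (intro finsum_cong') (auto simp: ins)
  also have "\<dots> = (b N N \<oplus> (\<Oplus>i\<in>{..<N}. b i N))
      \<oplus> (\<Oplus>j\<in>{..<N}. b N j \<oplus> (\<Oplus>i\<in>{..<N}. b i j))"
    by (rule ins) (use closed inner in blast)
  also have "b N N = \<zero>" using Suc.prems(2)[of N] by blast
  also have "(\<Oplus>j\<in>{..<N}. b N j \<oplus> (\<Oplus>i\<in>{..<N}. b i j)) =
      (\<Oplus>j\<in>{..<N}. b N j) \<oplus> (\<Oplus>j\<in>{..<N}. \<Oplus>i\<in>{..<N}. b i j)"
    by (intro finsum_addf funcsetI) (use closed inner in \<open>simp_all only: lessThan_iff less_imp_le_nat order_refl\<close>)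
  also have "\<dots> = (\<Oplus>j\<in>{..<N}. b N j)"
    unfolding IH by (intro r_zero finsum_closed funcsetI) (simp add: closed)
  also have "\<zero> \<oplus> (\<Oplus>i\<in>{..<N}. b i N) = (\<Oplus>i\<in>{..<N}. b i N)"
    by (intro l_zero inner) simp
  also have "(\<Oplus>i\<in>{..<N}. b i N) \<oplus> (\<Oplus>j\<in>{..<N}. b N j) = (\<Oplus>i\<in>{..<N}. b i N \<oplus> b N i)"
    by (intro finsum_addf[symmetric] funcsetI) (simp_all add: closed)
  also have "\<dots> = (\<Oplus>i\<in>{..<N}. \<zero>)"
  proof (intro finsum_cong' funcsetI)
    fix i assume "i \<in> {..<N}"
    then have "b N i = \<ominus> b i N" "b i N \<in> carrier R"
      using Suc.prems(1,3)[of i N] by simp_all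
    then show "b i N \<oplus> b N i = \<zero>" by (simp add: r_neg)
  qed simp_all
  finally show ?case by simp
qed

section \<open>Elementary alternating matrices and linear combinations\<close>

lemma AltI:
  assumes "a \<in> carrier_mat N N" "\<And>i j. i < N \<Longrightarrow> j < N \<Longrightarrow> a $$ (i, j) \<in> carrier R"
    and "\<And>i. i < N \<Longrightarrow> a $$ (i, i) = \<zero>\<^bsub>R\<^esub>"
    and "\<And>i j. i < N \<Longrightarrow> j < N \<Longrightarrow> a $$ (j, i) = \<ominus>\<^bsub>R\<^esub> a $$ (i, j)"
  shows "a \<in> Alt R N"
proof -
  have "elements_mat a \<subseteq> carrier R"
  proof
    fix s assume "s \<in> elements_mat a"
    then obtain i j where "i < dim_row a" "j < dim_col a" "s = a $$ (i, j)" by (blast dest: elements_matD)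
    then show "s \<in> carrier R" using assms(1,2) by simp
  qed
  then show ?thesis using assms unfolding Alt_def mats_def by blast
qed

lemma Alt_dim: "a \<in> Alt R N \<Longrightarrow> a \<in> carrier_mat N N"
  unfolding Alt_def mats_def by blast

lemma Alt_diag: "a \<in> Alt R N \<Longrightarrow> i < N \<Longrightarrow> a $$ (i, i) = \<zero>\<^bsub>R\<^esub>"
  unfolding Alt_def by blast

lemma Alt_swap: "a \<in> Alt R N \<Longrightarrow> i < N \<Longrightarrow> j < N \<Longrightarrow> a $$ (j, i) = \<ominus>\<^bsub>R\<^esub> a $$ (i, j)"
  unfolding Alt_def by blast

lemma Alt_index_closed:
  assumes "a \<in> Alt R N" "i < N" "j < N"
  shows "a $$ (i, j) \<in> carrier R"
proof -
  have "a \<in> mats R N N" using assms(1) unfolding Alt_def by blast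
  then show ?thesis using assms(2,3) unfolding mats_def by blast
qed

text \<open>The elementary alternating matrix E_ij - E_ji. For i = j the two terms cancel and it is
  zero, so no side condition on the indices is needed.\<close>

definition alt_unit :: "('a, 'b) ring_scheme \<Rightarrow> nat \<Rightarrow> nat \<Rightarrow> nat \<Rightarrow> 'a mat" where
  "alt_unit R N i j = mat N N (\<lambda>(r, l).
     (if r = i \<and> l = j then \<one>\<^bsub>R\<^esub> else \<zero>\<^bsub>R\<^esub>) \<ominus>\<^bsub>R\<^esub> (if l = i \<and> r = j then \<one>\<^bsub>R\<^esub> else \<zero>\<^bsub>R\<^esub>))"

text \<open>Matrix arithmetic has to use the operations of the record \<open>R\<close>. Closure
  under this single operation expresses being a submodule: sums, multiples and negatives are all
  instances.\<close>

definition lincomb_mat ::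
    "('a, 'b) ring_scheme \<Rightarrow> nat \<Rightarrow> 'a \<Rightarrow> 'a mat \<Rightarrow> 'a \<Rightarrow> 'a mat \<Rightarrow> 'a mat" where
  "lincomb_mat R N s a t b = mat N N (\<lambda>p. s \<otimes>\<^bsub>R\<^esub> a $$ p \<oplus>\<^bsub>R\<^esub> t \<otimes>\<^bsub>R\<^esub> b $$ p)"

lemma (in cring) lincomb_mat_Alt:
  assumes a: "a \<in> Alt R N" and b: "b \<in> Alt R N" and st: "s \<in> carrier R" "t \<in> carrier R"
  shows "lincomb_mat R N s a t b \<in> Alt R N"
proof (rule AltI)
  fix i j assume ij: "i < N" "j < N"
  note ca = Alt_index_closed[OF a ij] and cb = Alt_index_closed[OF b ij]
  have entry: "lincomb_mat R N s a t b $$ (i, j) = s \<otimes> a $$ (i, j) \<oplus> t \<otimes> b $$ (i, j)"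
    if "i < N" "j < N" for i j
    using that by (simp add: lincomb_mat_def)
  show "lincomb_mat R N s a t b $$ (i, j) \<in> carrier R"
    unfolding entry[OF ij] using ca cb st by simp
  have "s \<otimes> \<ominus> v \<oplus> t \<otimes> \<ominus> w = \<ominus> (s \<otimes> v \<oplus> t \<otimes> w)"
    if "v \<in> carrier R" "w \<in> carrier R" for v w
    using that st by algebra
  then show "lincomb_mat R N s a t b $$ (j, i) = \<ominus> lincomb_mat R N s a t b $$ (i, j)"
    unfolding entry[OF ij] entry[OF ij(2,1)] Alt_swap[OF a ij] Alt_swap[OF b ij]
    using ca cb by blast
next
  fix i assume "i < N"
  then show "lincomb_mat R N s a t b $$ (i, i) = \<zero>"
    using Alt_diag[OF a] Alt_diag[OF b] st by (simp add: lincomb_mat_def)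
qed (simp add: lincomb_mat_def)

lemma (in cring) alt_unit_Alt: "alt_unit R N i j \<in> Alt R N"
proof (rule AltI)
  let ?\<delta> = "\<lambda>r l. if r = i \<and> l = j then \<one> else \<zero>"
  have index: "alt_unit R N i j $$ (r, l) = ?\<delta> r l \<ominus> ?\<delta> l r" if "r < N" "l < N" for r l
    unfolding alt_unit_def index_mat(1)[OF that] by (simp only: prod.case)
  show "alt_unit R N i j $$ (r, l) \<in> carrier R" if "r < N" "l < N" for r l
    unfolding index[OF that] by simp
  show "alt_unit R N i j $$ (r, r) = \<zero>" if "r < N" for r
    unfolding index[OF that that] by (simp add: a_minus_def r_neg)
  have swap: "x \<ominus> y = \<ominus> (y \<ominus> x)" if "x \<in> carrier R" "y \<in> carrier R" for x y
    using that by algebra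
  show "alt_unit R N i j $$ (l, r) = \<ominus> alt_unit R N i j $$ (r, l)" if "r < N" "l < N" for r l
    unfolding index[OF that] index[OF that(2,1)] by (rule swap) simp_all
qed (simp add: alt_unit_def)

section \<open>The action of alternating matrices on row vectors\<close>

definition (in ring) row_action :: "nat \<Rightarrow> (nat \<Rightarrow> 'a) \<Rightarrow> 'a mat \<Rightarrow> nat \<Rightarrow> 'a" where
  "row_action N x a j = (\<Oplus>i\<in>{..<N}. x i \<otimes> a $$ (i, j))"

lemma (in cring) row_action_closed:
  assumes "\<And>i. i < N \<Longrightarrow> x i \<in> carrier R" "a \<in> Alt R N" "j < N"
  shows "row_action N x a j \<in> carrier R"
  unfolding row_action_def using assms Alt_index_closed[OF assms(2)] by (intro finsum_closed) auto

lemma (in cring) row_action_lincomb: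
  assumes x: "\<And>i. i < N \<Longrightarrow> x i \<in> carrier R"
    and "a \<in> Alt R N" "b \<in> Alt R N" "s \<in> carrier R" "t \<in> carrier R" "j < N"
  shows "row_action N x (lincomb_mat R N s a t b) j
    = s \<otimes> row_action N x a j \<oplus> t \<otimes> row_action N x b j"
proof -
  note c = x Alt_index_closed[OF assms(2)] Alt_index_closed[OF assms(3)]
  have "row_action N x (lincomb_mat R N s a t b) j
      = (\<Oplus>i\<in>{..<N}. s \<otimes> (x i \<otimes> a $$ (i, j)) \<oplus> t \<otimes> (x i \<otimes> b $$ (i, j)))"
    unfolding row_action_def lincomb_mat_def
    using assms(4-6) c by (intro finsum_cong') (auto simp: r_distr m_lcomm)
  also have "\<dots> = s \<otimes> row_action N x a j \<oplus> t \<otimes> row_action N x b j"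
    unfolding row_action_def using assms(4-6) c
    by (subst (1 2) finsum_rdistr) (auto intro!: finsum_addf)
  finally show ?thesis .
qed

lemma (in cring) row_action_smult:
  assumes "\<And>i. i < N \<Longrightarrow> x i \<in> carrier R" "a \<in> Alt R N" "s \<in> carrier R" "j < N"
  shows "row_action N (\<lambda>i. s \<otimes> x i) a j = s \<otimes> row_action N x a j"
  unfolding row_action_def using assms Alt_index_closed[OF assms(2)]
  by (subst finsum_rdistr) (auto intro!: finsum_cong' simp: m_assoc)

lemma (in cring) row_action_alt_unit:
  assumes x: "\<And>i. i < N \<Longrightarrow> x i \<in> carrier R" and "i < N" "j < N" "l < N"
  shows "row_action N x (alt_unit R N i j) l = wedge x i j l"
proof -
  have delta: "(\<Oplus>r\<in>{..<N}. if i = r then x r else \<zero>) = x i" if "i < N" for i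
    using that x by (intro finsum_singleton) auto
  have "row_action N x (alt_unit R N i j) l = (\<Oplus>r\<in>{..<N}.
      (if l = j then if i = r then x r else \<zero> else \<zero>)
      \<oplus> \<ominus> \<one> \<otimes> (if l = i then if j = r then x r else \<zero> else \<zero>))"
    unfolding row_action_def alt_unit_def using assms
    by (intro finsum_cong') (auto simp: a_minus_def l_minus r_minus r_distr)
  also have "\<dots> = (\<Oplus>r\<in>{..<N}. if l = j then if i = r then x r else \<zero> else \<zero>)
      \<oplus> \<ominus> \<one> \<otimes> (\<Oplus>r\<in>{..<N}. if l = i then if j = r then x r else \<zero> else \<zero>)"
    using assms by (subst finsum_addf) (auto simp: finsum_rdistr Pi_iff)
  also have "\<dots> = wedge x i j l"
    using assms delta by (auto simp: wedge_def a_minus_def l_minus)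
  finally show ?thesis .
qed

text \<open>The product (s y) a is paired with y and not with s y: as s may be a zero divisor, the
  pairing with s y would say less and would not determine the pivot coordinate. The terms s y_i a_ij
  y_j form an alternating array.\<close>

lemma (in cring) row_action_orthogonal:
  assumes y: "\<And>i. i < N \<Longrightarrow> y i \<in> carrier R" and "a \<in> Alt R N" "s \<in> carrier R"
  shows "(\<Oplus>j\<in>{..<N}. row_action N (\<lambda>i. s \<otimes> y i) a j \<otimes> y j) = \<zero>"
proof -
  note c = Alt_index_closed[OF assms(2)]
  have alt: "a $$ (i, i) = \<zero>" "a $$ (j, i) = \<ominus> a $$ (i, j)" if "i < N" "j < N" for i j
    using assms(2) that unfolding Alt_def by blast+
  have "(\<Oplus>j\<in>{..<N}. row_action N (\<lambda>i. s \<otimes> y i) a j \<otimes> y j)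
      = (\<Oplus>j\<in>{..<N}. \<Oplus>i\<in>{..<N}. (s \<otimes> y i) \<otimes> a $$ (i, j) \<otimes> y j)"
    unfolding row_action_def using assms c
    by (intro finsum_cong') (auto simp: finsum_ldistr)
  also have "\<dots> = \<zero>"
  proof (rule alternating_sum_zero)
    fix i j assume ij: "i < N" "j < N"
    note cc = assms(3) y[OF ij(1)] y[OF ij(2)] c[OF ij]
    show "s \<otimes> y i \<otimes> a $$ (i, j) \<otimes> y j \<in> carrier R" using cc by simp
    show "s \<otimes> y j \<otimes> a $$ (j, i) \<otimes> y i = \<ominus> (s \<otimes> y i \<otimes> a $$ (i, j) \<otimes> y j)"
      unfolding alt(2)[OF ij] using cc by algebra
  next
    fix i assume "i < N"
    then show "s \<otimes> y i \<otimes> a $$ (i, i) \<otimes> y i = \<zero>" using assms(3) y alt(1) by simp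
  qed
  finally show ?thesis .
qed

subsection \<open>Average kernel sizes over a finite chain ring\<close>

lemma finite_mats:
  assumes "finite (carrier R)"
  shows "finite (mats R m k)"
proof -
  have "mats R m k \<subseteq> mat m k ` (PiE ({..<m} \<times> {..<k}) (\<lambda>_. carrier R))"
  proof
    fix a assume a: "a \<in> mats R m k"
    have "a = mat m k (restrict (($$) a) ({..<m} \<times> {..<k}))"
    proof -
      have "a \<in> carrier_mat m k" using a unfolding mats_def by blast
      then show ?thesis by (intro eq_matI) auto
    qed
    moreover have "restrict (($$) a) ({..<m} \<times> {..<k}) \<in> PiE ({..<m} \<times> {..<k}) (\<lambda>_. carrier R)"
      unfolding restrict_PiE_iff using a unfolding mats_def by (blast intro: elements_matI)
    ultimately show "a \<in> mat m k ` (PiE ({..<m} \<times> {..<k}) (\<lambda>_. carrier R))" by blast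
  qed
  then show ?thesis
    using assms by (meson finite_PiE finite_SigmaI finite_imageI finite_lessThan finite_subset)
qed

text \<open>Kernels are moved from library vectors to extensional functions, so that all row vectors
  form a product set whose cardinality is known.\<close>

lemma card_row_kernel:
  assumes a: "a \<in> mats R N N" and "ring R"
  shows "card (row_kernel R a) =
    card {x \<in> {..<N} \<rightarrow>\<^sub>E carrier R. \<forall>j<N. ring.row_action R N x a j = \<zero>\<^bsub>R\<^esub>}"
proof (rule bij_betw_same_card)
  interpret ring R by fact
  have dims: "dim_row a = N" "dim_col a = N" using a by (auto simp: mats_def)
  have entries: "a $$ (i, j) \<in> carrier R" if "i < N" "j < N" for i j
    using a that unfolding mats_def by blast
  have eq: "row_action N (restrict (($) v) {..<N}) a j = (\<Oplus>\<^bsub>R\<^esub>i\<in>{..<N}. v $ i \<otimes>\<^bsub>R\<^esub> a $$ (i, j))"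
    if "j < N" "\<And>i. i < N \<Longrightarrow> v $ i \<in> carrier R" for v j
    unfolding row_action_def using that entries by (intro finsum_cong') auto
  have kernel: "row_kernel R a = {v \<in> carrier_vec N. (\<forall>i<N. v $ i \<in> carrier R) \<and>
      (\<forall>j<N. row_action N (restrict (($) v) {..<N}) a j = \<zero>\<^bsub>R\<^esub>)}"
  proof -
    have "set\<^sub>v v \<subseteq> carrier R \<longleftrightarrow> (\<forall>i<N. v $ i \<in> carrier R)" if "v \<in> carrier_vec N" for v
      using that by (auto simp: vec_set_def)
    then show ?thesis unfolding row_kernel_def dims by (auto simp: eq)
  qed
  show "bij_betw (\<lambda>v. restrict (($) v) {..<N}) (row_kernel R a)
      {x \<in> {..<N} \<rightarrow>\<^sub>E carrier R. \<forall>j<N. row_action N x a j = \<zero>\<^bsub>R\<^esub>}"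
  proof (rule bij_betw_byWitness[where f' = "vec N"])
    show "\<forall>v\<in>row_kernel R a. vec N (restrict (($) v) {..<N}) = v"
      unfolding kernel by auto
    have *: "restrict (($) (vec N x)) {..<N} = x" if "x \<in> {..<N} \<rightarrow>\<^sub>E carrier R" for x
      using that by (auto simp: PiE_iff extensional_def)
    then show "\<forall>x\<in>{x \<in> {..<N} \<rightarrow>\<^sub>E carrier R. \<forall>j<N. row_action N x a j = \<zero>\<^bsub>R\<^esub>}.
        restrict (($) (vec N x)) {..<N} = x" by blast
    show "(\<lambda>v. restrict (($) v) {..<N}) ` row_kernel R a
        \<subseteq> {x \<in> {..<N} \<rightarrow>\<^sub>E carrier R. \<forall>j<N. row_action N x a j = \<zero>\<^bsub>R\<^esub>}"
      unfolding kernel by (auto split: if_splits)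
    show "vec N ` {x \<in> {..<N} \<rightarrow>\<^sub>E carrier R. \<forall>j<N. row_action N x a j = \<zero>\<^bsub>R\<^esub>}
        \<subseteq> row_kernel R a"
      unfolding kernel using * by auto
  qed
qed

text \<open>The axioms list what survives of \<^const>\<open>ARel\<close> after reduction modulo the \<open>n\<close>-th ideal power.\<close>

locale admissible_matrix_module = cring R for R (structure) +
  fixes \<pi> and q n d e :: nat and C :: "'c set" and A :: "'c \<Rightarrow> (nat \<times> nat) set"
    and u :: "nat \<times> nat \<Rightarrow> 'a" and M :: "'a mat set"
  assumes finite_carrier: "finite (carrier R)"
    and \<pi>_closed [simp]: "\<pi> \<in> carrier R"
    and unit_or_divisible: "s \<in> carrier R \<Longrightarrow> s \<notin> Units R \<Longrightarrow> \<exists>t\<in>carrier R. s = \<pi> \<otimes> t"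
    and nilpotent: "\<pi> [^] n = \<zero>"
    and card_multiples: "k \<le> n \<Longrightarrow> card ((\<lambda>r. \<pi> [^] k \<otimes> r) ` carrier R) = q ^ (n - k)"
    and q_pos: "0 < q" and d_pos: "0 < d"
    and colouring: "partial_colouring d e C A"
    and admissible: "admissible d e C A"
    and u_unit: "p \<in> {..<d} \<times> {..<e} \<Longrightarrow> u p \<in> Units R"
    and M_alternating: "M \<subseteq> Alt R (d + e)"
    and M_lincomb: "a \<in> M \<Longrightarrow> b \<in> M \<Longrightarrow> s \<in> carrier R \<Longrightarrow> t \<in> carrier R \<Longrightarrow>
      lincomb_mat R (d + e) s a t b \<in> M"
    and M_same_block: "i < d + e \<Longrightarrow> j < d + e \<Longrightarrow> i < d \<longleftrightarrow> j < d \<Longrightarrow> alt_unit R (d + e) i j \<in> M"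
    and M_blank: "i < d \<Longrightarrow> j < e \<Longrightarrow> blank C A (i, j) \<Longrightarrow> alt_unit R (d + e) i (d + j) \<in> M"
    and M_colour: "c \<in> C \<Longrightarrow> (i, j) \<in> A c \<Longrightarrow> (i', j') \<in> A c \<Longrightarrow>
      lincomb_mat R (d + e) (u (i', j')) (alt_unit R (d + e) i (d + j))
        (\<ominus> u (i, j)) (alt_unit R (d + e) i' (d + j')) \<in> M"
begin

section \<open>The modules x M and their cardinalities\<close>

abbreviation "N \<equiv> d + e"

text \<open>The module x M. Restriction discards the values at indices from \<open>N\<close> on,
  where matrix entries carry no meaning, so that cardinalities count genuine vectors.\<close>

definition row_image :: "(nat \<Rightarrow> 'a) \<Rightarrow> (nat \<Rightarrow> 'a) set" where
  "row_image x = (\<lambda>a. restrict (row_action N x a) {..<N}) ` M"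

lemma finite_M: "finite M"
proof (rule finite_subset[OF _ finite_mats[OF finite_carrier]])
  show "M \<subseteq> mats R N N" using M_alternating unfolding Alt_def by blast
qed

lemma M_nonempty: "M \<noteq> {}"
  using M_same_block[of 0 0] d_pos by auto

text \<open>The coordinate at \<open>i0\<close> is then forced, see \<open>row_action_pivot\<close>.\<close>

lemma row_action_surj:
  assumes y: "\<And>i. y i \<in> carrier R" and i0: "i0 < N" "y i0 \<in> Units R"
    and r: "r \<in> {..<N} - {i0} \<rightarrow> carrier R"
  shows "\<exists>a\<in>M. \<forall>j\<in>{..<N} - {i0}. row_action N y a j = r j"
proof -
  \<comment> \<open>Coordinates from \<open>N\<close> on are left free. Hence a wedge, which is a
    total function, lies in \<open>W\<close> as soon as its first \<open>N\<close> coordinates come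
    from a matrix in \<open>M\<close>.\<close>
  define W where "W = {v \<in> UNIV \<rightarrow> carrier R. \<exists>a\<in>M. \<forall>j<N. v j = row_action N y a j}"
  have WI: "v \<in> W" if "a \<in> M" "\<And>j. v j \<in> carrier R" "\<And>j. j < N \<Longrightarrow> row_action N y a j = v j" for v a
    using that unfolding W_def by (intro CollectI conjI funcsetI bexI[of _ a]) auto
  have lin: "row_action N y (lincomb_mat R N s a t b) j = s \<otimes> row_action N y a j \<oplus> t \<otimes> row_action N y b j"
    if "a \<in> Alt R N" "b \<in> Alt R N" "s \<in> carrier R" "t \<in> carrier R" "j < N" for a b s t j
    by (rule row_action_lincomb[OF y that])
  note M_Alt = subsetD[OF M_alternating]
  have W_lin: "(\<lambda>l. s \<otimes> v l \<oplus> t \<otimes> w l) \<in> W"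
    if vw: "v \<in> W" "w \<in> W" and st: "s \<in> carrier R" "t \<in> carrier R" for v w s t
  proof -
    obtain a b where "a \<in> M" "\<forall>j<N. v j = row_action N y a j" "\<And>j. v j \<in> carrier R"
        "b \<in> M" "\<forall>j<N. w j = row_action N y b j" "\<And>j. w j \<in> carrier R"
      using vw unfolding W_def by blast
    then show ?thesis
      using st by (intro WI[OF M_lincomb[of a b s t]]) (auto simp: lin M_Alt)
  qed
  have W_carrier: "v l \<in> carrier R" if "v \<in> W" for v l using that by (auto simp: W_def)
  have zero: "(\<lambda>_. \<zero>) \<in> W"
  proof -
    obtain a where a: "a \<in> M" using M_nonempty by blast
    show ?thesis
      using row_action_closed[OF y M_Alt[OF a]]
      by (intro WI[OF M_lincomb[OF a a zero_closed zero_closed]]) (auto simp: lin M_Alt a)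
  qed
  have wedge_closed: "wedge y i j l \<in> carrier R" for i j l by (simp add: wedge_def y)
  have unit: "row_action N y (alt_unit R N i j) l = wedge y i j l"
    if "i < N" "j < N" "l < N" for i j l
    by (rule row_action_alt_unit[OF y that])
  interpret admissible_wedge_submodule R W \<pi> d N y e n C A u
  proof unfold_locales
    fix v w assume "v \<in> W" "w \<in> W"
    have "(\<lambda>l. \<one> \<otimes> v l \<oplus> \<one> \<otimes> w l) \<in> W" using W_lin \<open>v \<in> W\<close> \<open>w \<in> W\<close> by blast
    then show "(\<lambda>l. v l \<oplus> w l) \<in> W" using W_carrier \<open>v \<in> W\<close> \<open>w \<in> W\<close> by simp
  next
    fix v s assume vs: "s \<in> carrier R" "v \<in> W"
    have "(\<lambda>l. s \<otimes> v l \<oplus> \<zero> \<otimes> v l) \<in> W" using W_lin vs by blast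
    then show "(\<lambda>l. s \<otimes> v l) \<in> W" using W_carrier vs by simp
  next
    fix i j assume ij: "i < N" "j < N" "(i < d) = (j < d)"
    show "wedge y i j \<in> W"
      by (rule WI[OF M_same_block[OF ij]]) (simp_all add: wedge_closed unit ij)
  next
    fix i j assume ij: "i < d" "j < e" "blank C A (i, j)"
    show "wedge y i (d + j) \<in> W"
      by (rule WI[OF M_blank[OF ij]]) (use ij in \<open>simp_all add: wedge_closed unit\<close>)
  next
    fix c i j i' j' assume c: "c \<in> C" "(i, j) \<in> A c" "(i', j') \<in> A c"
    have cells: "(i, j) \<in> {..<d} \<times> {..<e}" "(i', j') \<in> {..<d} \<times> {..<e}"
      using colouring c unfolding partial_colouring_def by blast+
    have U: "u (i, j) \<in> carrier R" "u (i', j') \<in> carrier R" using u_unit cells by auto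
    show "(\<lambda>l. u (i', j') \<otimes> wedge y i (d + j) l \<ominus> u (i, j) \<otimes> wedge y i' (d + j') l) \<in> W"
      by (rule WI[OF M_colour[OF c]])
        (use cells U in \<open>simp_all add: wedge_closed lin alt_unit_Alt unit a_minus_def l_minus\<close>)
  next
    show "\<exists>i<N. y i \<in> Units R" using i0 by blast
  qed (use W_carrier zero unit_or_divisible y colouring admissible u_unit nilpotent in auto)
  obtain v where v: "v \<in> W" "\<forall>j\<in>{..<N} - {i0}. v j = r j"
    using prescribed_coordinates_mem[OF i0 r] by blast
  then obtain a where "a \<in> M" "\<forall>j<N. v j = row_action N y a j" unfolding W_def by blast
  then show ?thesis using v(2) by (intro bexI[of _ a]) auto
qed

text \<open>The orthogonality relation is solved for the coordinate at \<open>i0\<close>, which is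
  possible because y_i0 is a unit.\<close>

lemma row_action_pivot:
  assumes y: "\<And>i. y i \<in> carrier R" and i0: "i0 < N" "y i0 \<in> Units R"
    and a: "a \<in> M" and s: "s \<in> carrier R"
  shows "row_action N (\<lambda>i. s \<otimes> y i) a i0
    = \<ominus> (inv (y i0) \<otimes> (\<Oplus>j\<in>{..<N} - {i0}. row_action N (\<lambda>i. s \<otimes> y i) a j \<otimes> y j))"
proof -
  let ?r = "row_action N (\<lambda>i. s \<otimes> y i) a" and ?J = "{..<N} - {i0}"
  have aA: "a \<in> Alt R N" using a M_alternating by blast
  have r: "?r j \<in> carrier R" if "j < N" for j
    using row_action_closed[OF _ aA that] y s by simp
  have J: "{..<N} = insert i0 ?J" using i0 by auto
  let ?S = "\<Oplus>j\<in>?J. ?r j \<otimes> y j"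
  have S: "?S \<in> carrier R" using r y by (intro finsum_closed) auto
  have "(\<Oplus>j\<in>{..<N}. ?r j \<otimes> y j) = ?r i0 \<otimes> y i0 \<oplus> ?S"
    using r y i0 by (subst J, intro finsum_insert) auto
  then have "?r i0 \<otimes> y i0 \<oplus> ?S = \<zero>"
    using row_action_orthogonal[OF y aA s] by simp
  then have "?r i0 \<otimes> y i0 = \<ominus> ?S"
    using r[OF i0(1)] y S by (intro sum_zero_eq_neg) auto
  then have "inv (y i0) \<otimes> (y i0 \<otimes> ?r i0) = inv (y i0) \<otimes> \<ominus> ?S"
    using r[OF i0(1)] y by (simp add: m_comm)
  then show ?thesis
    using r[OF i0(1)] y i0 S by (simp add: m_assoc[symmetric] r_minus)
qed

text \<open>Dropping the pivot coordinate maps x M bijectively onto the vectors of length N - 1 with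
  entries in \<pi>^k R: injectively by \<open>row_action_pivot\<close>, surjectively by
  \<open>row_action_surj\<close>. There are q^(n-k) choices for each entry.\<close>

lemma card_row_image:
  assumes y: "\<And>i. y i \<in> carrier R" and i0: "i0 < N" "y i0 \<in> Units R" and k: "k \<le> n"
  shows "card (row_image (\<lambda>i. \<pi> [^] k \<otimes> y i)) = q ^ ((n - k) * (N - 1))"
proof -
  let ?J = "{..<N} - {i0}" and ?K = "(\<lambda>r. \<pi> [^] k \<otimes> r) ` carrier R"
  let ?x = "\<lambda>i. \<pi> [^] k \<otimes> y i"
  have act: "row_action N ?x a j = \<pi> [^] k \<otimes> row_action N y a j" if "a \<in> M" "j < N" for a j
    using row_action_smult[OF y] subsetD[OF M_alternating] that by simp
  have closed: "row_action N y a j \<in> carrier R" if "a \<in> M" "j < N" for a j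
    using row_action_closed[OF y] subsetD[OF M_alternating] that by simp
  have "bij_betw (\<lambda>v. restrict v ?J) (row_image ?x) (PiE ?J (\<lambda>_. ?K))"
    unfolding bij_betw_def
  proof (intro conjI inj_onI equalityI subsetI)
    fix v w assume vw: "v \<in> row_image ?x" "w \<in> row_image ?x" and eq: "restrict v ?J = restrict w ?J"
    obtain a b where ab: "a \<in> M" "v = restrict (row_action N ?x a) {..<N}"
        "b \<in> M" "w = restrict (row_action N ?x b) {..<N}"
      using vw unfolding row_image_def by blast
    have off: "row_action N ?x a j = row_action N ?x b j" if "j \<in> ?J" for j
      using fun_cong[OF eq, of j] that ab by auto
    have "(\<Oplus>j\<in>?J. row_action N ?x a j \<otimes> y j) = (\<Oplus>j\<in>?J. row_action N ?x b j \<otimes> y j)"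
      using off act closed ab y by (intro finsum_cong') auto
    then have "row_action N ?x a i0 = row_action N ?x b i0"
      using row_action_pivot[of y i0, OF y i0] ab by simp
    then have "row_action N ?x a j = row_action N ?x b j" if "j < N" for j
      using off[of j] that by (cases "j = i0") auto
    then show "v = w"
      unfolding ab(2,4) by (intro restrict_ext) simp
  next
    fix v assume "v \<in> (\<lambda>v. restrict v ?J) ` row_image ?x"
    then obtain a where a: "a \<in> M" "v = restrict (restrict (row_action N ?x a) {..<N}) ?J"
      unfolding row_image_def by blast
    then have "v j \<in> ?K" if "j \<in> ?J" for j using act[OF a(1)] closed[OF a(1)] that by simp
    then show "v \<in> PiE ?J (\<lambda>_. ?K)" using a(2) by (intro PiE_I) auto
  next
    fix v assume v: "v \<in> PiE ?J (\<lambda>_. ?K)"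
    then have "\<forall>j\<in>?J. \<exists>r\<in>carrier R. v j = \<pi> [^] k \<otimes> r" by blast
    then obtain r where r: "\<And>j. j \<in> ?J \<Longrightarrow> r j \<in> carrier R" "\<And>j. j \<in> ?J \<Longrightarrow> v j = \<pi> [^] k \<otimes> r j"
      by metis
    have "r \<in> ?J \<rightarrow> carrier R" using r(1) by blast
    from row_action_surj[of y i0, OF y i0 this]
    obtain a where a: "a \<in> M" "\<forall>j\<in>?J. row_action N y a j = r j" by blast
    have "v = restrict (restrict (row_action N ?x a) {..<N}) ?J"
    proof
      fix j show "v j = restrict (restrict (row_action N ?x a) {..<N}) ?J j"
      proof (cases "j \<in> ?J")
        case True
        then show ?thesis using r(2)[OF True] act[OF a(1), of j] a(2) by simp
      next
        case False
        then show ?thesis using PiE_arb[OF v False] by (simp only: restrict_apply if_False)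
      qed
    qed
    then show "v \<in> (\<lambda>v. restrict v ?J) ` row_image ?x" unfolding row_image_def using a(1) by blast
  qed
  then have "card (row_image ?x) = card (PiE ?J (\<lambda>_. ?K))" by (rule bij_betw_same_card)
  also have "\<dots> = q ^ ((n - k) * (N - 1))"
    using i0 by (simp add: card_PiE card_multiples[OF k] power_mult)
  finally show ?thesis .
qed

section \<open>Double counting of pairs (a, x) with x a = 0\<close>

definition annihilator :: "(nat \<Rightarrow> 'a) \<Rightarrow> 'a mat set" where
  "annihilator x = {a \<in> M. \<forall>j<N. row_action N x a j = \<zero>}"

text \<open>The map sending a to x a is additive on \<open>M\<close>, so its fibre through b is the
  translate by b of the annihilator of x.\<close>

lemma card_annihilator_times_card_row_image:
  assumes x: "\<And>i. i < N \<Longrightarrow> x i \<in> carrier R"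
  shows "card M = card (annihilator x) * card (row_image x)"
  unfolding row_image_def
proof (rule card_eq_card_fibre_times_card_image[OF finite_M])
  fix b assume b: "b \<in> M"
  let ?f = "\<lambda>a. restrict (row_action N x a) {..<N}"
  note M_Alt = subsetD[OF M_alternating]
  have entry: "a $$ (i, j) \<in> carrier R" if "a \<in> M" "i < N" "j < N" for a i j
    by (rule Alt_index_closed[OF M_Alt[OF that(1)] that(2,3)])
  have lin: "row_action N x (lincomb_mat R N \<one> a t b) j = row_action N x a j \<oplus> t \<otimes> row_action N x b j"
    if "a \<in> M" "t \<in> carrier R" "j < N" for a t j
    using row_action_lincomb[OF x M_Alt[OF that(1)] M_Alt[OF b] one_closed that(2,3)]
      row_action_closed[OF x M_Alt[OF that(1)] that(3)] by simp
  have closed: "row_action N x a j \<in> carrier R" if "a \<in> M" "j < N" for a j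
    by (rule row_action_closed[OF x M_Alt[OF that(1)] that(2)])
  have f_eq: "?f a = ?f b \<longleftrightarrow> (\<forall>j<N. row_action N x a j = row_action N x b j)" for a
  proof
    assume eq: "?f a = ?f b"
    show "\<forall>j<N. row_action N x a j = row_action N x b j"
      using fun_cong[OF eq] by (metis lessThan_iff restrict_apply')
  qed (auto intro: restrict_ext)
  \<comment> \<open>With {s, t} = {1, -1} in either order, this says that the translations by b and
    -b undo each other.\<close>
  have inverse: "lincomb_mat R N \<one> (lincomb_mat R N \<one> a t b) s b = a"
    if a: "a \<in> M" and st: "s \<in> carrier R" "t \<in> carrier R" "t \<oplus> s = \<zero>" for a s t
  proof (rule eq_matI)
    have "a \<in> carrier_mat N N" using M_Alt[OF a] unfolding Alt_def mats_def by blast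
    then have dims: "dim_row a = N" "dim_col a = N" by auto
    show "dim_row (lincomb_mat R N \<one> (lincomb_mat R N \<one> a t b) s b) = dim_row a"
      "dim_col (lincomb_mat R N \<one> (lincomb_mat R N \<one> a t b) s b) = dim_col a"
      by (simp_all add: lincomb_mat_def dims)
    fix i j assume "i < dim_row a" "j < dim_col a"
    then have ij: "i < N" "j < N" using dims by auto
    have "v \<oplus> t \<otimes> w \<oplus> s \<otimes> w = v" if "v \<in> carrier R" "w \<in> carrier R" for v w
    proof -
      have "v \<oplus> t \<otimes> w \<oplus> s \<otimes> w = v \<oplus> (t \<oplus> s) \<otimes> w" using that st(1,2) by algebra
      then show ?thesis using that st(3) by simp
    qed
    then show "lincomb_mat R N \<one> (lincomb_mat R N \<one> a t b) s b $$ (i, j) = a $$ (i, j)"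
      using entry[OF a ij] entry[OF b ij] ij st by (simp add: lincomb_mat_def)
  qed
  have "bij_betw (\<lambda>a. lincomb_mat R N \<one> a (\<ominus> \<one>) b) {a \<in> M. ?f a = ?f b} (annihilator x)"
  proof (rule bij_betw_byWitness[where f' = "\<lambda>a. lincomb_mat R N \<one> a \<one> b"])
    show "\<forall>a\<in>{a \<in> M. ?f a = ?f b}.
        lincomb_mat R N \<one> (lincomb_mat R N \<one> a (\<ominus> \<one>) b) \<one> b = a"
      using inverse[of _ \<one> "\<ominus> \<one>"] by (simp add: l_neg)
    show "\<forall>a\<in>annihilator x. lincomb_mat R N \<one> (lincomb_mat R N \<one> a \<one> b) (\<ominus> \<one>) b = a"
      using inverse[of _ "\<ominus> \<one>" \<one>] by (simp add: r_neg annihilator_def)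
    show "(\<lambda>a. lincomb_mat R N \<one> a (\<ominus> \<one>) b) ` {a \<in> M. ?f a = ?f b} \<subseteq> annihilator x"
      unfolding f_eq annihilator_def using b M_lincomb closed
      by (auto simp: lin l_minus r_neg)
    show "(\<lambda>a. lincomb_mat R N \<one> a \<one> b) ` annihilator x \<subseteq> {a \<in> M. ?f a = ?f b}"
      unfolding f_eq annihilator_def using b M_lincomb closed by (auto simp: lin)
  qed
  then show "card {a \<in> M. ?f a = ?f b} = card (annihilator x)" by (rule bij_betw_same_card)
qed

text \<open>Counting the pairs by x instead of a turns the average into the sum of the ratios of the
  annihilator of x to \<open>M\<close>, and each ratio is the reciprocal of the size of x M.\<close>

lemma ask_eq_sum:
  "ask R M = (\<Sum>x\<in>{..<N} \<rightarrow>\<^sub>E carrier R. 1 / of_nat (card (row_image x)))"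
proof -
  let ?X = "{..<N} \<rightarrow>\<^sub>E carrier R"
  have X: "finite ?X" using finite_carrier by (intro finite_PiE) auto
  have M0: "card M \<noteq> 0" using finite_M M_nonempty by simp
  have "(\<Sum>a\<in>M. card (row_kernel R a)) = (\<Sum>a\<in>M. card {x \<in> ?X. \<forall>j<N. row_action N x a j = \<zero>})"
  proof (rule sum.cong[OF refl])
    fix a assume "a \<in> M"
    then have "a \<in> mats R N N" using M_alternating unfolding Alt_def by blast
    then show "card (row_kernel R a) = card {x \<in> ?X. \<forall>j<N. row_action N x a j = \<zero>}"
      by (rule card_row_kernel) (rule ring_axioms)
  qed
  also have "\<dots> = (\<Sum>a\<in>M. \<Sum>x\<in>?X. if \<forall>j<N. row_action N x a j = \<zero> then 1 else 0)"
    using X by (simp add: sum.If_cases Int_def)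
  also have "\<dots> = (\<Sum>x\<in>?X. \<Sum>a\<in>M. if \<forall>j<N. row_action N x a j = \<zero> then 1 else 0)"
    by (rule sum.swap)
  also have "\<dots> = (\<Sum>x\<in>?X. card (annihilator x))"
    using finite_M by (simp add: sum.If_cases Int_def annihilator_def)
  finally have *: "(\<Sum>a\<in>M. card (row_kernel R a)) = (\<Sum>x\<in>?X. card (annihilator x))" .
  have "ask R M = (\<Sum>x\<in>?X. of_nat (card (annihilator x)) / of_nat (card M))"
    unfolding ask_def using * by (simp flip: of_nat_sum sum_divide_distrib)
  also have "\<dots> = (\<Sum>x\<in>?X. 1 / of_nat (card (row_image x)))"
  proof (rule sum.cong[OF refl])
    fix x assume "x \<in> ?X"
    then have "card M = card (annihilator x) * card (row_image x)"
      by (intro card_annihilator_times_card_row_image) auto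
    then show "of_nat (card (annihilator x)) / of_nat (card M) = (1::rat) / of_nat (card (row_image x))"
      using M0 by simp
  qed
  finally show ?thesis .
qed

section \<open>Summation over row vectors by their divisibility by \<pi>\<close>

abbreviation multiples :: "nat \<Rightarrow> 'a set" where
  "multiples k \<equiv> (\<lambda>r. \<pi> [^] k \<otimes> r) ` carrier R"

lemma multiples_decseq: "multiples (Suc k) \<subseteq> multiples k"
proof
  fix s assume "s \<in> multiples (Suc k)"
  then obtain r where r: "r \<in> carrier R" "s = \<pi> [^] Suc k \<otimes> r" by blast
  have "s = \<pi> [^] k \<otimes> (\<pi> \<otimes> r)" using r by (simp add: m_assoc)
  then show "s \<in> multiples k" using r(1) by (intro image_eqI[of _ _ "\<pi> \<otimes> r"]) simp_all
qed

lemma row_image_cong: "(\<And>i. i < N \<Longrightarrow> x i = y i) \<Longrightarrow> (\<And>i. i < N \<Longrightarrow> y i \<in> carrier R) \<Longrightarrow> row_image x = row_image y"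
proof -
  assume xy: "\<And>i. i < N \<Longrightarrow> x i = y i" "\<And>i. i < N \<Longrightarrow> y i \<in> carrier R"
  have "row_action N x a j = row_action N y a j" if "a \<in> M" "j < N" for a j
    unfolding row_action_def
    using xy Alt_index_closed[OF subsetD[OF M_alternating that(1)] _ that(2)]
    by (intro finsum_cong') auto
  then show "row_image x = row_image y"
    unfolding row_image_def by (intro image_cong[OF refl] restrict_ext) auto
qed

text \<open>Writing x = \<pi>^k y, a coordinate of x outside \<pi>^(k+1) R forces the same
  coordinate of y to be a unit, so \<open>card_row_image\<close> applies.\<close>

lemma card_row_image_stratum:
  assumes "k < n" "x \<in> {..<N} \<rightarrow>\<^sub>E multiples k" "x \<notin> {..<N} \<rightarrow>\<^sub>E multiples (Suc k)"
  shows "card (row_image x) = q ^ ((n - k) * (N - 1))"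
proof -
  have "\<forall>i\<in>{..<N}. \<exists>r\<in>carrier R. x i = \<pi> [^] k \<otimes> r" using assms(2) by blast
  then obtain r where r: "\<And>i. i \<in> {..<N} \<Longrightarrow> r i \<in> carrier R" "\<And>i. i \<in> {..<N} \<Longrightarrow> x i = \<pi> [^] k \<otimes> r i"
    by metis
  \<comment> \<open>The quotients \<open>r\<close> are controlled only below \<open>N\<close>; the
    extension by zero gives ring elements at every index, as \<open>card_row_image\<close>
    requires.\<close>
  define y where "y i = (if i < N then r i else \<zero>)" for i
  have y: "y i \<in> carrier R" for i using r(1) by (simp add: y_def)
  obtain i0 where i0: "i0 < N" "x i0 \<notin> multiples (Suc k)"
    using assms(2,3) by (auto simp: PiE_iff)
  have "y i0 \<in> Units R"
  proof (rule ccontr)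
    assume "y i0 \<notin> Units R"
    then obtain t where t: "t \<in> carrier R" "y i0 = \<pi> \<otimes> t" using unit_or_divisible y by blast
    then have "x i0 = \<pi> [^] Suc k \<otimes> t" using r(2)[of i0] i0(1) by (simp add: y_def m_assoc)
    then show False using i0(2) t(1) by blast
  qed
  moreover have "row_image x = row_image (\<lambda>i. \<pi> [^] k \<otimes> y i)"
    using r by (intro row_image_cong) (auto simp: y_def)
  ultimately show ?thesis using card_row_image[OF y i0(1)] assms(1) by simp
qed

text \<open>With m = n - k, the vectors divisible by exactly \<pi>^k number q^(mN) - q^((m-1)N), and
  each contributes q^(-m(N-1)). Together they give (1 - q^(-N)) q^m, the new summand in the downward
  induction on k.\<close>

lemma sum_over_strata:
  assumes "k \<le> n"
  shows "(\<Sum>x\<in>{..<N} \<rightarrow>\<^sub>E multiples k. 1 / of_nat (card (row_image x)) :: rat)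
    = 1 + (1 - 1 / of_nat q ^ N) * (\<Sum>m=1..n - k. of_nat q ^ m)"
  using assms
proof (induction rule: inc_induct)
  case base
  let ?X = "{..<N} \<rightarrow>\<^sub>E multiples n"
  have "card (row_image x) = 1" if "x \<in> ?X" for x
  proof -
    \<comment> \<open>Only the zero vector remains for k = n. It is written as \<pi>^n times the
      all-ones vector, which has a unit coordinate.\<close>
    have "row_image x = row_image (\<lambda>i. \<pi> [^] n \<otimes> \<one>)"
      using that by (intro row_image_cong) (auto simp: nilpotent)
    then show ?thesis using card_row_image[of "\<lambda>_. \<one>" 0 n] d_pos by simp
  qed
  then have "(\<Sum>x\<in>?X. 1 / of_nat (card (row_image x)) :: rat) = of_nat (card ?X)" by simp
  also have "card ?X = 1" by (simp add: card_PiE card_multiples)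
  finally show ?case by simp
next
  case (step k)
  let ?X = "\<lambda>k. {..<N} \<rightarrow>\<^sub>E multiples k"
  have fin: "finite (?X k)" for k using finite_carrier by (intro finite_PiE) auto
  have sub: "?X (Suc k) \<subseteq> ?X k" using multiples_decseq by (intro PiE_mono) auto
  have cardX: "card (?X k) = q ^ ((n - k) * N)" if "k \<le> n" for k
    using that by (simp add: card_PiE card_multiples power_mult)
  obtain m where m: "n - k = Suc m" "n - Suc k = m" using step.hyps by (metis Suc_diff_Suc)
  have q: "(of_nat q :: rat) \<noteq> 0" using q_pos by simp
  have "(\<Sum>x\<in>?X k. 1 / of_nat (card (row_image x)) :: rat)
      = (\<Sum>x\<in>?X k - ?X (Suc k). 1 / of_nat (card (row_image x)))
        + (\<Sum>x\<in>?X (Suc k). 1 / of_nat (card (row_image x)))"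
    using sum.subset_diff[OF sub fin] .
  also have "(\<Sum>x\<in>?X k - ?X (Suc k). 1 / of_nat (card (row_image x)) :: rat)
      = (\<Sum>x\<in>?X k - ?X (Suc k). 1 / of_nat q ^ (Suc m * (N - 1)))"
    using card_row_image_stratum[OF step.hyps(2)] m by (intro sum.cong) auto
  also have "\<dots> = (of_nat q ^ (Suc m * N) - of_nat q ^ (m * N)) / of_nat q ^ (Suc m * (N - 1))"
  proof -
    have "card (?X (Suc k)) \<le> card (?X k)" using sub fin by (intro card_mono)
    then show ?thesis
      using card_Diff_subset[OF fin sub] cardX[of k] cardX[of "Suc k"] step.hyps(2) m
      by (simp add: of_nat_diff)
  qed
  also have "\<dots> = (1 - 1 / of_nat q ^ N) * of_nat q ^ Suc m"
  proof -
    \<comment> \<open>As \<open>d\<close> is positive, N - 1 is not a truncated subtraction.\<close>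
    obtain N' where N': "N = Suc N'" using d_pos by (metis gr0_implies_Suc add_gr_0)
    have "(of_nat q :: rat) ^ (Suc m * N) = of_nat q ^ Suc m * of_nat q ^ (Suc m * N')"
      by (simp add: N' flip: power_add)
    moreover have "(of_nat q :: rat) ^ (m * N) * of_nat q ^ N = of_nat q ^ (Suc m * N)"
      by (simp flip: power_add add: algebra_simps)
    ultimately show ?thesis
      using q by (simp add: N' field_simps del: power_Suc)
  qed
  finally show ?case
    using step.IH m by (simp add: algebra_simps)
qed

lemma ask_eq: "ask R M = 1 + (1 - 1 / of_nat q ^ N) * (\<Sum>m=1..n. of_nat q ^ m)"
proof -
  have "multiples 0 = carrier R" by force
  then show ?thesis using sum_over_strata[of 0] ask_eq_sum by simp
qed

end

subsection \<open>Quotients of a compact discrete valuation ring\<close>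

text \<open>The fibres of multiplication by p are the cosets of its kernel.\<close>

lemma (in cring) card_carrier_eq_card_kernel_times_card_multiples:
  assumes "finite (carrier R)" "p \<in> carrier R"
  shows "card (carrier R) = card {a \<in> carrier R. p \<otimes> a = \<zero>} * card ((\<lambda>a. p \<otimes> a) ` carrier R)"
proof (rule card_eq_card_fibre_times_card_image[OF assms(1)])
  fix b assume b: "b \<in> carrier R"
  have "bij_betw (\<lambda>a. a \<ominus> b) {a \<in> carrier R. p \<otimes> a = p \<otimes> b} {a \<in> carrier R. p \<otimes> a = \<zero>}"
  proof (rule bij_betw_byWitness[where f' = "\<lambda>a. a \<oplus> b"])
    have "a \<ominus> b \<oplus> b = a" "a \<oplus> b \<ominus> b = a" if "a \<in> carrier R" for a
      using that b by algebra+
    then show "\<forall>a\<in>{a \<in> carrier R. p \<otimes> a = p \<otimes> b}. a \<ominus> b \<oplus> b = a"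
      "\<forall>a\<in>{a \<in> carrier R. p \<otimes> a = \<zero>}. a \<oplus> b \<ominus> b = a" by auto
    have "p \<otimes> (a \<ominus> b) = p \<otimes> a \<ominus> p \<otimes> b" "p \<otimes> (a \<oplus> b) = p \<otimes> a \<oplus> p \<otimes> b"
      if "a \<in> carrier R" for a
      using that b assms(2) by algebra+
    then show "(\<lambda>a. a \<ominus> b) ` {a \<in> carrier R. p \<otimes> a = p \<otimes> b} \<subseteq> {a \<in> carrier R. p \<otimes> a = \<zero>}"
      "(\<lambda>a. a \<oplus> b) ` {a \<in> carrier R. p \<otimes> a = \<zero>} \<subseteq> {a \<in> carrier R. p \<otimes> a = p \<otimes> b}"
      using b assms(2) by (auto simp: a_minus_def r_neg)
  qed
  then show "card {a \<in> carrier R. p \<otimes> a = p \<otimes> b} = card {a \<in> carrier R. p \<otimes> a = \<zero>}"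
    by (rule bij_betw_same_card)
qed

locale uniformized_compact_dvr = compact_discrete_valuation_ring R P
  for R (structure) and P +
  fixes \<pi> :: 'a
  assumes \<pi>_closed [simp]: "\<pi> \<in> carrier R"
    and P_eq: "P = PIdl \<pi>"
begin

text \<open>Otherwise the zero ideal would be maximal and R a field.\<close>

lemma \<pi>_nonzero: "\<pi> \<noteq> \<zero>"
proof
  assume "\<pi> = \<zero>"
  then have "P = {\<zero>}" unfolding P_eq by (auto simp: cgenideal_def intro: exI[of _ \<zero>])
  then show False using maximalideal_P zeromaximalideal_fieldI not_field by blast
qed

lemma \<pi>_pow_nonzero: "\<pi> [^] (k::nat) \<noteq> \<zero>"
  by (induction k) (simp_all add: \<pi>_nonzero integral_iff)

text \<open>A nonzero nonunit has an irreducible divisor. In a principal ideal domain this generates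
  a maximal ideal, which can only be P, so \<pi> divides as well.\<close>

lemma nonunit_divisible:
  assumes "s \<in> carrier R" "s \<notin> Units R"
  shows "\<exists>t\<in>carrier R. s = \<pi> \<otimes> t"
proof (cases "s = \<zero>")
  case True
  then show ?thesis by (intro bexI[of _ \<zero>]) auto
next
  case False
  then obtain b where b: "b \<in> carrier R" "ring_irreducible b" "b divides s"
    using exists_irreducible_divisor[of s] assms by blast
  have "PIdl b = P" using unique_maximalideal irreducible_imp_maximalideal b by blast
  then have "PIdl s \<subseteq> PIdl \<pi>" using to_contain_is_to_divide[OF b(1) assms(1)] b(3) P_eq by simp
  then show ?thesis
    using to_contain_is_to_divide[OF \<pi>_closed assms(1)] unfolding factor_def by blast
qed

lemma P_pow: "P [^]\<^bsub>ideals_set R\<^esub> (n::nat) = PIdl (\<pi> [^] n)"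
proof (induction n)
  case 0
  have "PIdl \<one> = carrier R" using ideal_eq_carrier_iff[of \<one>] by simp
  then show ?case by (simp add: nat_pow_def ideals_set_def)
next
  case (Suc n)
  have "P [^]\<^bsub>ideals_set R\<^esub> Suc n = ideal_prod R (PIdl (\<pi> [^] n)) (PIdl \<pi>)"
    using Suc by (simp add: ideals_set_def P_eq)
  also have "\<dots> = Idl (PIdl (\<pi> [^] n) <#> PIdl \<pi>)"
    by (intro ideal_prod_eq_genideal cgenideal_ideal) auto
  also have "\<dots> = PIdl (\<pi> [^] Suc n)"
  proof -
    have ideal: "ideal (PIdl (\<pi> [^] Suc n)) R" by (intro cgenideal_ideal) simp
    then have "PIdl (\<pi> [^] Suc n) \<subseteq> carrier R" by (blast dest: ideal.Icarr)
    then have "Idl (PIdl (\<pi> [^] Suc n)) = PIdl (\<pi> [^] Suc n)"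
      by (rule subset_antisym[OF genideal_minimal[OF ideal order_refl] genideal_self])
    then show ?thesis
      using cgenideal_prod[OF nat_pow_closed[OF \<pi>_closed, of n] \<pi>_closed] by simp
  qed
  finally show ?case .
qed

section \<open>Residue rings modulo powers of P and their cardinalities\<close>

abbreviation I :: "nat \<Rightarrow> 'a set" where "I n \<equiv> P [^]\<^bsub>ideals_set R\<^esub> n"
abbreviation S :: "nat \<Rightarrow> 'a set ring" where "S n \<equiv> R Quot I n"
abbreviation red :: "nat \<Rightarrow> 'a \<Rightarrow> 'a set" where "red n r \<equiv> I n +> r"

lemma I_ideal: "ideal (I n) R"
  unfolding P_pow by (intro cgenideal_ideal) simp

lemma red_hom: "ring_hom_cring R (S n) (red n)"
  by (rule ideal.rcos_ring_hom_cring[OF I_ideal is_cring])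

lemma carrier_S: "carrier (S n) = red n ` carrier R"
  by (auto simp: FactRing_def A_RCOSETS_def')

lemma red_eq_iff:
  assumes "r \<in> carrier R" "s \<in> carrier R"
  shows "red n r = red n s \<longleftrightarrow> (\<exists>t\<in>carrier R. r \<ominus> s = \<pi> [^] n \<otimes> t)"
  unfolding quotient_eq_iff_same_a_r_cos[OF I_ideal assms, symmetric]
  unfolding P_pow cgenideal_def
  using m_comm[OF _ nat_pow_closed[OF \<pi>_closed, of n]] by (simp add: Bex_def) metis

text \<open>R is a domain, so \<pi>^k cancels from a congruence modulo \<pi>^n between multiples of
  \<pi>^k.\<close>

lemma red_pow_mult_eq_iff:
  assumes "k \<le> n" "r \<in> carrier R" "s \<in> carrier R"
  shows "red n (\<pi> [^] k \<otimes> r) = red n (\<pi> [^] k \<otimes> s) \<longleftrightarrow> red (n - k) r = red (n - k) s"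
proof -
  have pow: "\<pi> [^] n = \<pi> [^] k \<otimes> \<pi> [^] (n - k)"
    using assms(1) by (simp add: nat_pow_mult)
  have "\<pi> [^] k \<otimes> r \<ominus> \<pi> [^] k \<otimes> s = \<pi> [^] n \<otimes> t \<longleftrightarrow> r \<ominus> s = \<pi> [^] (n - k) \<otimes> t"
    if t: "t \<in> carrier R" for t
  proof -
    have "\<pi> [^] k \<otimes> r \<ominus> \<pi> [^] k \<otimes> s = \<pi> [^] k \<otimes> (r \<ominus> s)"
      using assms(2,3) nat_pow_closed[OF \<pi>_closed, of k] by algebra
    moreover have "\<pi> [^] n \<otimes> t = \<pi> [^] k \<otimes> (\<pi> [^] (n - k) \<otimes> t)"
      using t by (simp add: pow m_assoc)
    ultimately show ?thesis
      using m_lcancel[OF \<pi>_pow_nonzero[of k]] assms(2,3) t by simp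
  qed
  then show ?thesis
    using assms(2,3) by (simp add: red_eq_iff)
qed

text \<open>The cosets of \<open>I n\<close> form an open cover of the compact space R. They are
  disjoint and nonempty, so a finite subcover must contain all of them.\<close>

lemma finite_S: "finite (carrier (S n))"
proof -
  interpret ideal "I n" R by (rule I_ideal)
  let ?X = "adic_topology R P"
  have open_coset: "openin ?X c" if "c \<in> a_rcosets (I n)" for c
    unfolding adic_topology_def by (rule topology_generated_by_Basis) (use that in blast)
  have "topspace ?X = carrier R"
  proof -
    have "\<Union>(a_rcosets (I m)) = carrier R" for m
    proof -
      interpret Im: ideal "I m" R by (rule I_ideal)
      show ?thesis by (rule Im.a_rcosets_part_G)
    qed
    moreover have "topspace ?X = (\<Union>m. \<Union>(a_rcosets (I m)))"
      unfolding adic_topology_def topology_generated_by_topspace by blast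
    ultimately show ?thesis by simp
  qed
  then obtain F where F: "finite F" "F \<subseteq> a_rcosets (I n)" "\<Union>F = carrier R"
    using compact open_coset a_rcosets_part_G unfolding compact_space by metis
  have "a_rcosets (I n) \<subseteq> F"
  proof
    fix c assume c: "c \<in> a_rcosets (I n)"
    then obtain r where r: "r \<in> carrier R" "c = I n +> r" by (auto simp: A_RCOSETS_def')
    then have "r \<in> c" using a_rcos_self by simp
    moreover obtain c' where c': "c' \<in> F" "r \<in> c'" using F(3) r(1) by blast
    ultimately have "c = c'"
      using a_rcos_disjoint c F(2) unfolding pairwise_def disjnt_def by blast
    then show "c \<in> F" using c' by simp
  qed
  then show ?thesis using F(1) finite_subset by (auto simp: FactRing_def)
qed

lemma S_pow_red: "red n \<pi> [^]\<^bsub>S n\<^esub> (k::nat) = red n (\<pi> [^] k)"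
proof -
  interpret ring_hom_cring R "S n" "red n" by (rule red_hom)
  show ?thesis by (induction k) simp_all
qed

text \<open>On R, the maps r to \<pi>^k r modulo \<pi>^n and r to r modulo \<pi>^(n-k) have the same
  fibres, hence images of equal size.\<close>

lemma card_multiples_S:
  assumes "k \<le> n"
  shows "card ((\<lambda>r. red n \<pi> [^]\<^bsub>S n\<^esub> k \<otimes>\<^bsub>S n\<^esub> r) ` carrier (S n)) = card (carrier (S (n - k)))"
proof -
  interpret ring_hom_cring R "S n" "red n" by (rule red_hom)
  have "(\<lambda>r. red n \<pi> [^]\<^bsub>S n\<^esub> k \<otimes>\<^bsub>S n\<^esub> r) ` carrier (S n) = (\<lambda>r. red n (\<pi> [^] k \<otimes> r)) ` carrier R"
    unfolding carrier_S image_image S_pow_red by (intro image_cong[OF refl]) simp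
  also have "card \<dots> = card (red (n - k) ` carrier R)"
    using red_pow_mult_eq_iff[OF assms] by (intro card_image_eq_if_same_fibres) auto
  finally show ?thesis by (simp add: carrier_S)
qed

text \<open>In \<open>S (Suc n)\<close>, the kernel of multiplication by \<pi> is generated by
  \<pi>^n and has the size of \<open>S 1\<close>, while the image has the size of
  \<open>S n\<close>.\<close>

lemma card_S_Suc: "card (carrier (S (Suc n))) = card (carrier (S 1)) * card (carrier (S n))"
proof -
  define m where "m = Suc n"
  let ?T = "S m" and ?h = "red m"
  interpret h: ring_hom_cring R ?T ?h by (rule red_hom)
  have zero: "?h r = \<zero>\<^bsub>?T\<^esub> \<longleftrightarrow> (\<exists>t\<in>carrier R. r = \<pi> [^] m \<otimes> t)" if "r \<in> carrier R" for r
  proof -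
    have "r \<ominus> \<zero> = r" using that by (simp add: a_minus_def)
    then show ?thesis
      using red_eq_iff[OF that zero_closed, of "m"] unfolding h.hom_zero by (simp only:)
  qed
  have kernel_iff: "?h \<pi> \<otimes>\<^bsub>?T\<^esub> ?h r = \<zero>\<^bsub>?T\<^esub> \<longleftrightarrow> (\<exists>t\<in>carrier R. r = \<pi> [^] n \<otimes> t)"
    if r: "r \<in> carrier R" for r
  proof -
    have "?h \<pi> \<otimes>\<^bsub>?T\<^esub> ?h r = ?h (\<pi> \<otimes> r)"
      by (rule h.hom_mult[OF \<pi>_closed r, symmetric])
    moreover have "\<pi> \<otimes> r = \<pi> [^] m \<otimes> t \<longleftrightarrow> r = \<pi> [^] n \<otimes> t" if "t \<in> carrier R" for t
    proof -
      have "\<pi> [^] m \<otimes> t = \<pi> \<otimes> (\<pi> [^] n \<otimes> t)"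
        using that by (simp add: m_def m_ac)
      then show ?thesis using m_lcancel[OF \<pi>_nonzero] r that by simp
    qed
    ultimately show ?thesis using zero[of "\<pi> \<otimes> r"] r by auto
  qed
  have "{a \<in> carrier ?T. ?h \<pi> \<otimes>\<^bsub>?T\<^esub> a = \<zero>\<^bsub>?T\<^esub>} = (\<lambda>r. ?h \<pi> [^]\<^bsub>?T\<^esub> n \<otimes>\<^bsub>?T\<^esub> r) ` carrier ?T"
  proof (intro equalityI subsetI)
    fix a assume "a \<in> {a \<in> carrier ?T. ?h \<pi> \<otimes>\<^bsub>?T\<^esub> a = \<zero>\<^bsub>?T\<^esub>}"
    then obtain r where r: "r \<in> carrier R" "a = ?h r" "?h \<pi> \<otimes>\<^bsub>?T\<^esub> ?h r = \<zero>\<^bsub>?T\<^esub>"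
      unfolding carrier_S by blast
    then obtain t where t: "t \<in> carrier R" "r = \<pi> [^] n \<otimes> t" using kernel_iff by blast
    have "a = ?h \<pi> [^]\<^bsub>?T\<^esub> n \<otimes>\<^bsub>?T\<^esub> ?h t"
      unfolding r(2) t(2) S_pow_red by (rule h.hom_mult[OF nat_pow_closed[OF \<pi>_closed] t(1)])
    then show "a \<in> (\<lambda>r. ?h \<pi> [^]\<^bsub>?T\<^esub> n \<otimes>\<^bsub>?T\<^esub> r) ` carrier ?T"
      using h.hom_closed[OF t(1)] by (rule image_eqI)
  next
    fix a assume "a \<in> (\<lambda>r. ?h \<pi> [^]\<^bsub>?T\<^esub> n \<otimes>\<^bsub>?T\<^esub> r) ` carrier ?T"
    then obtain t where t: "t \<in> carrier R" "a = ?h \<pi> [^]\<^bsub>?T\<^esub> n \<otimes>\<^bsub>?T\<^esub> ?h t"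
      unfolding carrier_S by blast
    have a: "a = ?h (\<pi> [^] n \<otimes> t)"
      unfolding t(2) S_pow_red by (rule h.hom_mult[OF nat_pow_closed[OF \<pi>_closed] t(1), symmetric])
    have "?h \<pi> \<otimes>\<^bsub>?T\<^esub> a = \<zero>\<^bsub>?T\<^esub>"
      unfolding a using kernel_iff[OF m_closed[OF nat_pow_closed[OF \<pi>_closed, of n] t(1)]] t(1)
      by blast
    then show "a \<in> {a \<in> carrier ?T. ?h \<pi> \<otimes>\<^bsub>?T\<^esub> a = \<zero>\<^bsub>?T\<^esub>}"
      using h.hom_closed[of "\<pi> [^] n \<otimes> t"] t(1) unfolding a by simp
  qed
  moreover have "card ((\<lambda>a. ?h \<pi> \<otimes>\<^bsub>?T\<^esub> a) ` carrier ?T) = card (carrier (S n))"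
  proof -
    have "?h \<pi> [^]\<^bsub>?T\<^esub> (1::nat) = ?h \<pi>" unfolding S_pow_red by simp
    then show ?thesis using card_multiples_S[of 1 m] by (simp only: m_def) simp
  qed
  ultimately show ?thesis
    using cring.card_carrier_eq_card_kernel_times_card_multiples[OF h.S.is_cring finite_S
        h.hom_closed[OF \<pi>_closed]]
      card_multiples_S[of n m] by (simp add: m_def)
qed

lemma card_S: "card (carrier (S n)) = card (carrier (R Quot P)) ^ n"
proof (induction n)
  case 0
  have "red 0 r = red 0 \<zero>" if "r \<in> carrier R" for r
  proof -
    have "r \<ominus> \<zero> = \<pi> [^] (0::nat) \<otimes> r" using that by (simp add: a_minus_def)
    then show ?thesis using red_eq_iff[OF that zero_closed] that by blast
  qed
  then have "carrier (S 0) = {red 0 \<zero>}" unfolding carrier_S using zero_closed by blast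
  then show ?case by simp
next
  case (Suc n)
  have "I 1 = P" using P_pow[of 1] P_eq by simp
  then show ?case using card_S_Suc[of n] Suc by simp
qed

end

subsection \<open>Reduction of antisymmetric relation modules\<close>

text \<open>The defining sum of \<open>Rel\<close> for one colour class, read off the upper right
  block of the large matrix: the cell (i,j) is the entry (i, d + j).\<close>

definition colour_sum :: "('a, 'b) ring_scheme \<Rightarrow> nat \<Rightarrow> 'a mat \<Rightarrow> (nat \<times> nat) set \<Rightarrow> 'a mat \<Rightarrow> 'a" where
  "colour_sum R d u B m = (\<Oplus>\<^bsub>R\<^esub>p\<in>B. u $$ p \<otimes>\<^bsub>R\<^esub> m $$ (fst p, d + snd p))"

text \<open>In an alternating matrix both diagonal blocks are alternating and the lower left block
  is minus the transpose of the upper right one. Only the colour equations remain, and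
  \<open>ARel\<close> becomes the solution set of linear equations in \<open>Alt\<close>.\<close>

lemma (in cring) ARel_eq:
  assumes "partial_colouring d e C A" "u \<in> mats R d e"
  shows "ARel R d e C A u = {m \<in> Alt R (d + e). \<forall>c\<in>C. colour_sum R d u (A c) m = \<zero>}"
proof (intro equalityI subsetI)
  have u: "u $$ p \<in> carrier R" if "p \<in> {..<d} \<times> {..<e}" for p
    using assms(2) that unfolding mats_def by blast
  have cells: "A c \<subseteq> {..<d} \<times> {..<e}" if "c \<in> C" for c
    using assms(1) that unfolding partial_colouring_def by blast
  have sum_eq: "colour_sum R d u (A c) m = (\<Oplus>p\<in>A c. u $$ p \<otimes> x $$ p)"
    if c: "c \<in> C" and mx: "\<And>i j. i < d \<Longrightarrow> j < e \<Longrightarrow> m $$ (i, d + j) = x $$ (i, j)"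
      and x: "\<And>i j. i < d \<Longrightarrow> j < e \<Longrightarrow> x $$ (i, j) \<in> carrier R" for c m x
    unfolding colour_sum_def
  proof (rule finsum_cong'[OF refl])
    show "(\<lambda>p. u $$ p \<otimes> x $$ p) \<in> A c \<rightarrow> carrier R"
    proof
      fix p assume "p \<in> A c"
      then obtain i j where p: "p = (i, j)" "i < d" "j < e" using cells[OF c] by auto
      then show "u $$ p \<otimes> x $$ p \<in> carrier R" using u[of p] x by simp
    qed
    fix p assume "p \<in> A c"
    then obtain i j where "p = (i, j)" "i < d" "j < e" using cells[OF c] by auto
    then show "u $$ p \<otimes> m $$ (fst p, d + snd p) = u $$ p \<otimes> x $$ p" using mx by simp
  qed
  {
    fix m assume "m \<in> ARel R d e C A u"
    then obtain a b x where m: "m = four_block_mat a x (map_mat (a_inv R) (transpose_mat x)) b"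
      and a: "a \<in> Alt R d" and b: "b \<in> Alt R e" and x: "x \<in> Rel R d e C A u"
      unfolding ARel_def by blast
    have xm: "x \<in> mats R d e" using x unfolding Rel_def by blast
    have dims: "a \<in> carrier_mat d d" "b \<in> carrier_mat e e" "x \<in> carrier_mat d e"
      using Alt_dim[OF a] Alt_dim[OF b] xm unfolding mats_def by blast+
    have cx: "x $$ (i, j) \<in> carrier R" if "i < d" "j < e" for i j
      using xm that unfolding mats_def by blast
    have entry: "m $$ (i, j) = (if i < d then if j < d then a $$ (i, j) else x $$ (i, j - d)
        else if j < d then \<ominus> x $$ (j, i - d) else b $$ (i - d, j - d))"
      if "i < d + e" "j < d + e" for i j
      unfolding m using that dims by auto
    have "m \<in> Alt R (d + e)"
    proof (rule AltI)
      show "m \<in> carrier_mat (d + e) (d + e)" unfolding m using dims by auto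
      fix i j assume ij: "i < d + e" "j < d + e"
      show "m $$ (i, j) \<in> carrier R"
        unfolding entry[OF ij]
        using ij Alt_index_closed[OF a, of i j] Alt_index_closed[OF b, of "i - d" "j - d"]
          cx[of i "j - d"] cx[of j "i - d"] by auto
      show "m $$ (j, i) = \<ominus> m $$ (i, j)"
        unfolding entry[OF ij] entry[OF ij(2,1)]
        using ij Alt_swap[OF a, of i j] Alt_swap[OF b, of "i - d" "j - d"]
          cx[of i "j - d"] cx[of j "i - d"] by (cases "i < d"; cases "j < d") simp_all
    next
      fix i assume i: "i < d + e"
      show "m $$ (i, i) = \<zero>"
        unfolding entry[OF i i] using i Alt_diag[OF a, of i] Alt_diag[OF b, of "i - d"] by auto
    qed
    moreover have "colour_sum R d u (A c) m = \<zero>" if "c \<in> C" for c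
      using sum_eq[OF that, of m x] entry cx x that unfolding Rel_def by simp
    ultimately show "m \<in> {m \<in> Alt R (d + e). \<forall>c\<in>C. colour_sum R d u (A c) m = \<zero>}" by blast
  }
  fix m assume "m \<in> {m \<in> Alt R (d + e). \<forall>c\<in>C. colour_sum R d u (A c) m = \<zero>}"
  then have m: "m \<in> Alt R (d + e)" and sums: "\<And>c. c \<in> C \<Longrightarrow> colour_sum R d u (A c) m = \<zero>" by blast+
  define a where "a = mat d d (($$) m)"
  define b where "b = mat e e (\<lambda>(i, j). m $$ (d + i, d + j))"
  define x where "x = mat d e (\<lambda>(i, j). m $$ (i, d + j))"
  have "a \<in> Alt R d"
  proof (rule AltI)
    fix i j assume "i < d" "j < d"
    then show "a $$ (i, j) \<in> carrier R" "a $$ (j, i) = \<ominus> a $$ (i, j)"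
      using Alt_index_closed[OF m, of i j] Alt_swap[OF m, of i j] by (simp_all add: a_def)
  qed (simp_all add: a_def Alt_diag[OF m])
  moreover have "b \<in> Alt R e"
  proof (rule AltI)
    fix i j assume "i < e" "j < e"
    then show "b $$ (i, j) \<in> carrier R" "b $$ (j, i) = \<ominus> b $$ (i, j)"
      using Alt_index_closed[OF m, of "d + i" "d + j"] Alt_swap[OF m, of "d + i" "d + j"]
      by (simp_all add: b_def)
  qed (simp_all add: b_def Alt_diag[OF m])
  moreover have "x \<in> Rel R d e C A u"
  proof -
    have cx: "x $$ (i, j) \<in> carrier R" if "i < d" "j < e" for i j
      using that Alt_index_closed[OF m, of i "d + j"] by (simp add: x_def)
    have "x \<in> mats R d e"
    proof -
      have "x \<in> carrier_mat d e" by (simp add: x_def)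
      moreover have "elements_mat x \<subseteq> carrier R"
      proof
        fix s assume "s \<in> elements_mat x"
        then obtain i j where "i < dim_row x" "j < dim_col x" "s = x $$ (i, j)"
          by (blast dest: elements_matD)
        then show "s \<in> carrier R" using cx by (simp add: x_def)
      qed
      ultimately show ?thesis unfolding mats_def by blast
    qed
    moreover have "(\<Oplus>p\<in>A c. u $$ p \<otimes> x $$ p) = \<zero>" if "c \<in> C" for c
      using sum_eq[OF that, of m x] sums[OF that] cx by (simp add: x_def)
    ultimately show ?thesis unfolding Rel_def by blast
  qed
  moreover have "m = four_block_mat a x (map_mat (a_inv R) (transpose_mat x)) b"
  proof (rule eq_matI)
    show "dim_row m = dim_row (four_block_mat a x (map_mat (a_inv R) (transpose_mat x)) b)"
      "dim_col m = dim_col (four_block_mat a x (map_mat (a_inv R) (transpose_mat x)) b)"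
      using Alt_dim[OF m] by (simp_all add: a_def b_def)
    fix i j
    assume "i < dim_row (four_block_mat a x (map_mat (a_inv R) (transpose_mat x)) b)"
      and "j < dim_col (four_block_mat a x (map_mat (a_inv R) (transpose_mat x)) b)"
    then have ij: "i < d + e" "j < d + e" by (simp_all add: a_def b_def)
    then show "m $$ (i, j) = four_block_mat a x (map_mat (a_inv R) (transpose_mat x)) b $$ (i, j)"
      using Alt_swap[OF m ij(2,1)] by (auto simp: a_def b_def x_def)
  qed
  ultimately show "m \<in> ARel R d e C A u" unfolding ARel_def by blast
qed

lemma (in cring) colour_sum_lincomb:
  assumes "B \<subseteq> {..<d} \<times> {..<e}" "u \<in> mats R d e" "a \<in> Alt R (d + e)" "b \<in> Alt R (d + e)"
    "s \<in> carrier R" "t \<in> carrier R"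
  shows "colour_sum R d u B (lincomb_mat R (d + e) s a t b)
    = s \<otimes> colour_sum R d u B a \<oplus> t \<otimes> colour_sum R d u B b"
proof -
  have fin: "finite B" using assms(1) by (rule finite_subset) simp
  have c: "u $$ p \<in> carrier R" "a $$ (fst p, d + snd p) \<in> carrier R"
    "b $$ (fst p, d + snd p) \<in> carrier R"
    "lincomb_mat R (d + e) s a t b $$ (fst p, d + snd p)
      = s \<otimes> a $$ (fst p, d + snd p) \<oplus> t \<otimes> b $$ (fst p, d + snd p)" if pB: "p \<in> B" for p
  proof -
    obtain i j where p: "p = (i, j)" "i < d" "j < e" using assms(1) pB by auto
    show "u $$ p \<in> carrier R" using assms(2) p unfolding mats_def by blast
    show "a $$ (fst p, d + snd p) \<in> carrier R" "b $$ (fst p, d + snd p) \<in> carrier R"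
      using p Alt_index_closed[OF assms(3)] Alt_index_closed[OF assms(4)] by simp_all
    show "lincomb_mat R (d + e) s a t b $$ (fst p, d + snd p)
      = s \<otimes> a $$ (fst p, d + snd p) \<oplus> t \<otimes> b $$ (fst p, d + snd p)"
      using p by (simp add: lincomb_mat_def)
  qed
  have "colour_sum R d u B (lincomb_mat R (d + e) s a t b)
      = (\<Oplus>p\<in>B. s \<otimes> (u $$ p \<otimes> a $$ (fst p, d + snd p)) \<oplus> t \<otimes> (u $$ p \<otimes> b $$ (fst p, d + snd p)))"
    unfolding colour_sum_def
    using c assms(5,6) by (intro finsum_cong') (auto simp: r_distr m_lcomm)
  also have "\<dots> = s \<otimes> colour_sum R d u B a \<oplus> t \<otimes> colour_sum R d u B b"
    unfolding colour_sum_def using c assms(5,6) fin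
    by (subst (1 2) finsum_rdistr) (auto intro!: finsum_addf)
  finally show ?thesis .
qed

text \<open>For a row index i and a column index d + j, only the entry +1 lies in the upper right
  block; its mirror image lies in the lower left one. For two indices of the same kind, neither
  entry lies in the upper right block.\<close>

lemma (in cring) colour_sum_alt_unit:
  assumes B: "B \<subseteq> {..<d} \<times> {..<e}" and u: "u \<in> mats R d e"
  shows "i < d \<Longrightarrow> j < e \<Longrightarrow>
      colour_sum R d u B (alt_unit R (d + e) i (d + j)) = (if (i, j) \<in> B then u $$ (i, j) else \<zero>)"
    and "i < d \<longleftrightarrow> j < d \<Longrightarrow> colour_sum R d u B (alt_unit R (d + e) i j) = \<zero>"
proof -
  have fin: "finite B" using B by (rule finite_subset) simp
  have cu: "u $$ p \<in> carrier R" if "p \<in> B" for p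
    using that u B unfolding mats_def by (cases p) blast
  have entry: "alt_unit R (d + e) i j $$ (r, d + l)
      = (if r = i \<and> d + l = j then \<one> else \<zero>) \<ominus> (if d + l = i \<and> r = j then \<one> else \<zero>)"
    if "r < d" "l < e" for i j r l
    using that unfolding alt_unit_def by simp
  show "colour_sum R d u B (alt_unit R (d + e) i (d + j)) = (if (i, j) \<in> B then u $$ (i, j) else \<zero>)"
    if "i < d" "j < e"
  proof -
    have "colour_sum R d u B (alt_unit R (d + e) i (d + j))
        = (\<Oplus>p\<in>B. if (i, j) = p then u $$ p else \<zero>)"
      unfolding colour_sum_def
    proof (rule finsum_cong'[OF refl])
      fix p assume p: "p \<in> B"
      then obtain r l where rl: "p = (r, l)" "r < d" "l < e" using B by auto
      show "u $$ p \<otimes> alt_unit R (d + e) i (d + j) $$ (fst p, d + snd p)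
          = (if (i, j) = p then u $$ p else \<zero>)"
        using rl cu[OF p] that by (auto simp: entry a_minus_def)
    qed (use cu in auto)
    also have "\<dots> = (if (i, j) \<in> B then u $$ (i, j) else \<zero>)"
    proof (cases "(i, j) \<in> B")
      case True
      then show ?thesis using finsum_singleton[OF True fin, of "($$) u"] cu by auto
    next
      case False
      then have "(\<Oplus>p\<in>B. if (i, j) = p then u $$ p else \<zero>) = (\<Oplus>p\<in>B. \<zero>)"
        by (intro finsum_cong') auto
      then show ?thesis using False by simp
    qed
    finally show ?thesis .
  qed
  show "colour_sum R d u B (alt_unit R (d + e) i j) = \<zero>" if ij: "i < d \<longleftrightarrow> j < d"
  proof -
    have "colour_sum R d u B (alt_unit R (d + e) i j) = (\<Oplus>p\<in>B. \<zero>)"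
      unfolding colour_sum_def
    proof (rule finsum_cong'[OF refl])
      fix p assume p: "p \<in> B"
      then obtain r l where rl: "p = (r, l)" "r < d" "l < e" using B by auto
      have "\<not> (r = i \<and> d + l = j)" "\<not> (d + l = i \<and> r = j)" using rl ij by auto
      then have "alt_unit R (d + e) i j $$ (r, d + l) = \<zero>"
        unfolding entry[OF rl(2,3)] by (simp only: if_False) (simp add: a_minus_def)
      then show "u $$ p \<otimes> alt_unit R (d + e) i j $$ (fst p, d + snd p) = \<zero>"
        using rl(1) cu[OF p] by simp
    qed simp
    then show ?thesis by simp
  qed
qed

section \<open>Transport of matrices along a ring homomorphism\<close>

lemma (in ring_hom_cring) map_mat_Alt:
  assumes a: "a \<in> Alt R N"
  shows "map_mat h a \<in> Alt S N"
proof (rule AltI)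
  have dims: "dim_row a = N" "dim_col a = N" using Alt_dim[OF a] by auto
  show "map_mat h a \<in> carrier_mat N N" using Alt_dim[OF a] by simp
  fix i j assume ij: "i < N" "j < N"
  show "map_mat h a $$ (i, j) \<in> carrier S" "map_mat h a $$ (j, i) = \<ominus>\<^bsub>S\<^esub> map_mat h a $$ (i, j)"
    using ij dims Alt_index_closed[OF a ij] Alt_swap[OF a ij] by simp_all
next
  fix i assume "i < N"
  then show "map_mat h a $$ (i, i) = \<zero>\<^bsub>S\<^esub>"
    using Alt_dim[OF a] Alt_diag[OF a] by simp
qed

lemma (in ring_hom_cring) map_mat_lincomb:
  assumes a: "a \<in> Alt R N" and b: "b \<in> Alt R N" and st: "s \<in> carrier R" "t \<in> carrier R"
  shows "map_mat h (lincomb_mat R N s a t b) = lincomb_mat S N (h s) (map_mat h a) (h t) (map_mat h b)"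
proof (rule eq_matI)
  fix i j
  assume "i < dim_row (lincomb_mat S N (h s) (map_mat h a) (h t) (map_mat h b))"
    and "j < dim_col (lincomb_mat S N (h s) (map_mat h a) (h t) (map_mat h b))"
  then have ij: "i < N" "j < N" by (simp_all add: lincomb_mat_def)
  then show "map_mat h (lincomb_mat R N s a t b) $$ (i, j)
      = lincomb_mat S N (h s) (map_mat h a) (h t) (map_mat h b) $$ (i, j)"
    using Alt_dim[OF a] Alt_dim[OF b] Alt_index_closed[OF a ij] Alt_index_closed[OF b ij] st
    by (simp add: lincomb_mat_def)
qed (simp_all add: lincomb_mat_def)

lemma (in ring_hom_cring) map_mat_alt_unit: "map_mat h (alt_unit R N i j) = alt_unit S N i j"
proof (rule eq_matI)
  fix r l
  assume "r < dim_row (alt_unit S N i j)" "l < dim_col (alt_unit S N i j)"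
  then have rl: "r < N" "l < N" by (simp_all add: alt_unit_def)
  have "h ((if b then \<one>\<^bsub>R\<^esub> else \<zero>\<^bsub>R\<^esub>) \<ominus>\<^bsub>R\<^esub> (if b' then \<one>\<^bsub>R\<^esub> else \<zero>\<^bsub>R\<^esub>))
      = (if b then \<one>\<^bsub>S\<^esub> else \<zero>\<^bsub>S\<^esub>) \<ominus>\<^bsub>S\<^esub> (if b' then \<one>\<^bsub>S\<^esub> else \<zero>\<^bsub>S\<^esub>)" for b b'
    by (cases b; cases b') (simp_all add: a_minus_def)
  moreover have "map_mat h (alt_unit R N i j) $$ (r, l) = h (alt_unit R N i j $$ (r, l))"
    using rl by (intro index_map_mat) (simp_all add: alt_unit_def)
  ultimately show "map_mat h (alt_unit R N i j) $$ (r, l) = alt_unit S N i j $$ (r, l)"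
    unfolding alt_unit_def index_mat(1)[OF rl] prod.case by (simp only:)
qed (simp_all add: alt_unit_def)

lemma (in ring_hom_cring) hom_Units:
  assumes "s \<in> Units R"
  shows "h s \<in> Units S"
proof -
  obtain t where "s \<in> carrier R" "t \<in> carrier R" "t \<otimes>\<^bsub>R\<^esub> s = \<one>\<^bsub>R\<^esub>" "s \<otimes>\<^bsub>R\<^esub> t = \<one>\<^bsub>R\<^esub>"
    using assms unfolding Units_def by blast
  then have "h t \<otimes>\<^bsub>S\<^esub> h s = \<one>\<^bsub>S\<^esub>" "h s \<otimes>\<^bsub>S\<^esub> h t = \<one>\<^bsub>S\<^esub>" "h s \<in> carrier S" "h t \<in> carrier S"
    by (simp_all flip: hom_mult)
  then show ?thesis unfolding Units_def by blast
qed

context uniformized_compact_dvr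
begin

text \<open>Every required matrix over the quotient is lifted to R, where membership in
  \<open>ARel\<close> is a matter of linear equations, and then reduced. Reduction commutes with
  linear combinations and preserves elementary alternating matrices.\<close>

lemma admissible_matrix_module_reduced_ARel:
  assumes d: "0 < d" and col: "partial_colouring d e C A" and u: "u \<in> mats R d e"
    and unit: "elements_mat u \<subseteq> Units R" and adm: "admissible d e C A"
  shows "admissible_matrix_module (S n) (red n \<pi>) (card (carrier (R Quot P))) n d e C A
    (\<lambda>p. red n (u $$ p)) (map_mat (red n) ` ARel R d e C A u)"
proof -
  let ?N = "d + e" and ?M = "ARel R d e C A u"
  interpret h: ring_hom_cring R "S n" "red n" by (rule red_hom)
  have unit_u: "u $$ p \<in> Units R" if "p \<in> {..<d} \<times> {..<e}" for p
    using u unit that unfolding mats_def by blast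
  have cells: "A c \<subseteq> {..<d} \<times> {..<e}" if "c \<in> C" for c
    using col that unfolding partial_colouring_def by blast
  have MI: "m \<in> ?M" if "m \<in> Alt R ?N" "\<And>c. c \<in> C \<Longrightarrow> colour_sum R d u (A c) m = \<zero>" for m
    using ARel_eq[OF col u] that by blast
  have M_Alt: "m \<in> Alt R ?N" if "m \<in> ?M" for m
    using ARel_eq[OF col u] that by blast
  have M_sum: "colour_sum R d u (A c) m = \<zero>" if "m \<in> ?M" "c \<in> C" for m c
    using ARel_eq[OF col u] that by blast
  show ?thesis
  proof (intro admissible_matrix_module.intro admissible_matrix_module_axioms.intro)
    show "cring (S n)" by (rule h.S.is_cring)
    show "finite (carrier (S n))" by (rule finite_S)
    show "red n \<pi> \<in> carrier (S n)" by (rule h.hom_closed) simp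
    show "\<exists>t\<in>carrier (S n). s = red n \<pi> \<otimes>\<^bsub>S n\<^esub> t"
      if s: "s \<in> carrier (S n)" "s \<notin> Units (S n)" for s
    proof -
      obtain r where r: "r \<in> carrier R" "s = red n r" using s(1) unfolding carrier_S by blast
      then have "r \<notin> Units R" using h.hom_Units s(2) by blast
      then obtain t where t: "t \<in> carrier R" "r = \<pi> \<otimes> t" using nonunit_divisible r(1) by blast
      then show ?thesis using r(2) by (intro bexI[of _ "red n t"]) simp_all
    qed
    show "red n \<pi> [^]\<^bsub>S n\<^esub> n = \<zero>\<^bsub>S n\<^esub>"
    proof -
      have "\<pi> [^] n \<ominus> \<zero> = \<pi> [^] n \<otimes> \<one>" by (simp add: a_minus_def)
      then have "red n (\<pi> [^] n) = red n \<zero>" 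
        using red_eq_iff[OF nat_pow_closed[OF \<pi>_closed] zero_closed, of n n] by blast
      then show ?thesis unfolding S_pow_red by simp
    qed
    show "card ((\<lambda>r. red n \<pi> [^]\<^bsub>S n\<^esub> k \<otimes>\<^bsub>S n\<^esub> r) ` carrier (S n)) = card (carrier (R Quot P)) ^ (n - k)"
      if "k \<le> n" for k
      using card_multiples_S[OF that] card_S by simp
    show "0 < card (carrier (R Quot P))"
    proof -
      have "I 1 = P" using P_pow[of 1] P_eq by simp
      moreover have "carrier (S 1) \<noteq> {}" unfolding carrier_S using zero_closed by blast
      ultimately show ?thesis using finite_S[of 1] by (simp add: card_gt_0_iff)
    qed
    show "red n (u $$ p) \<in> Units (S n)" if "p \<in> {..<d} \<times> {..<e}" for p
      using h.hom_Units unit_u that by blast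
    show "map_mat (red n) ` ?M \<subseteq> Alt (S n) (d + e)"
      using h.map_mat_Alt M_Alt by blast
    show "lincomb_mat (S n) (d + e) s a t b \<in> map_mat (red n) ` ?M"
      if ab: "a \<in> map_mat (red n) ` ?M" "b \<in> map_mat (red n) ` ?M"
        and st: "s \<in> carrier (S n)" "t \<in> carrier (S n)" for a b s t
    proof -
      obtain a' b' where a': "a' \<in> ?M" "a = map_mat (red n) a'" and b': "b' \<in> ?M" "b = map_mat (red n) b'"
        using ab by blast
      obtain s' t' where s': "s' \<in> carrier R" "s = red n s'" and t': "t' \<in> carrier R" "t = red n t'"
        using st unfolding carrier_S by blast
      have "lincomb_mat R ?N s' a' t' b' \<in> ?M"
      proof (rule MI)
        show "lincomb_mat R ?N s' a' t' b' \<in> Alt R ?N"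
          by (rule lincomb_mat_Alt[OF M_Alt[OF a'(1)] M_Alt[OF b'(1)] s'(1) t'(1)])
        show "colour_sum R d u (A c) (lincomb_mat R ?N s' a' t' b') = \<zero>" if "c \<in> C" for c
          using colour_sum_lincomb[OF cells[OF that] u M_Alt[OF a'(1)] M_Alt[OF b'(1)] s'(1) t'(1)]
            M_sum[OF a'(1) that] M_sum[OF b'(1) that] s'(1) t'(1) by simp
      qed
      then show ?thesis
        unfolding a'(2) b'(2) s'(2) t'(2)
          h.map_mat_lincomb[OF M_Alt[OF a'(1)] M_Alt[OF b'(1)] s'(1) t'(1), symmetric]
        by (rule imageI)
    qed
    show "alt_unit (S n) (d + e) i j \<in> map_mat (red n) ` ?M"
      if "i < d + e" "j < d + e" "i < d \<longleftrightarrow> j < d" for i j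
      unfolding h.map_mat_alt_unit[symmetric]
      using MI[OF alt_unit_Alt colour_sum_alt_unit(2)[OF cells u that(3)]] by (rule imageI)
    show "alt_unit (S n) (d + e) i (d + j) \<in> map_mat (red n) ` ?M"
      if ij: "i < d" "j < e" "blank C A (i, j)" for i j
    proof -
      have "colour_sum R d u (A c) (alt_unit R ?N i (d + j)) = \<zero>" if "c \<in> C" for c
        using colour_sum_alt_unit(1)[OF cells[OF that] u ij(1,2)] ij(3) that
        unfolding blank_def by simp
      then show ?thesis
        unfolding h.map_mat_alt_unit[symmetric] by (intro imageI MI alt_unit_Alt)
    qed
    show "lincomb_mat (S n) (d + e) (red n (u $$ (i', j'))) (alt_unit (S n) (d + e) i (d + j))
        (\<ominus>\<^bsub>S n\<^esub> red n (u $$ (i, j))) (alt_unit (S n) (d + e) i' (d + j')) \<in> map_mat (red n) ` ?M"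
      if c: "c \<in> C" "(i, j) \<in> A c" "(i', j') \<in> A c" for c i j i' j'
    proof -
      \<comment> \<open>The coefficients are swapped so that the sum for colour c is u(i',j') u(i,j)
        - u(i,j) u(i',j') = 0.\<close>
      let ?m = "lincomb_mat R ?N (u $$ (i', j')) (alt_unit R ?N i (d + j))
        (\<ominus> (u $$ (i, j))) (alt_unit R ?N i' (d + j'))"
      have ij: "i < d" "j < e" "i' < d" "j' < e" using cells[OF c(1)] c(2,3) by auto
      have U: "u $$ (i, j) \<in> carrier R" "u $$ (i', j') \<in> carrier R"
        using unit_u cells[OF c(1)] c(2,3) by blast+
      have "?m \<in> ?M"
      proof (rule MI)
        show "?m \<in> Alt R ?N" using U by (intro lincomb_mat_Alt alt_unit_Alt) auto
        fix b assume b: "b \<in> C"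
        \<comment> \<open>Colour classes are disjoint, so the equations of the other colours involve
          neither cell.\<close>
        have iff: "(i, j) \<in> A b \<longleftrightarrow> b = c" "(i', j') \<in> A b \<longleftrightarrow> b = c"
          using col c b unfolding partial_colouring_def disjoint_family_on_def by blast+
        have "colour_sum R d u (A b) ?m
            = u $$ (i', j') \<otimes> (if b = c then u $$ (i, j) else \<zero>)
              \<oplus> \<ominus> (u $$ (i, j)) \<otimes> (if b = c then u $$ (i', j') else \<zero>)"
          using U colour_sum_lincomb[OF cells[OF b] u alt_unit_Alt alt_unit_Alt]
            colour_sum_alt_unit(1)[OF cells[OF b] u ij(1,2)]
            colour_sum_alt_unit(1)[OF cells[OF b] u ij(3,4)]
          by (simp only: iff a_inv_closed)
        also have "\<dots> = \<zero>"
          using U by (simp add: l_minus m_comm r_neg)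
        finally show "colour_sum R d u (A b) ?m = \<zero>" .
      qed
      then have "map_mat (red n) ?m \<in> map_mat (red n) ` ?M" by (rule imageI)
      then show ?thesis
        using h.map_mat_lincomb[OF alt_unit_Alt[of ?N i "d + j"] alt_unit_Alt[of ?N i' "d + j'"]
            U(2) a_inv_closed[OF U(1)]]
        unfolding h.map_mat_alt_unit h.hom_a_inv[OF U(1)] by (simp only:)
    qed
  qed (use d col adm in auto)
qed

end

section \<open>The generating function and the final formula\<close>

lemma fps_eq_rational_function:
  fixes q c :: rat
  shows "Abs_fps (\<lambda>n. 1 + (1 - c) * (\<Sum>m=1..n. q ^ m)) =
    (1 - fps_const (q * c) * fps_X) / ((1 - fps_X) * (1 - fps_const q * fps_X))"
proof -
  let ?F = "Abs_fps (\<lambda>n. 1 + (1 - c) * (\<Sum>m=1..n. q ^ m))"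
  let ?D = "(1 - fps_X) * (1 - fps_const q * fps_X)"
  \<comment> \<open>Multiplication by 1 - X takes differences of consecutive coefficients, which
    strips the geometric sum to its last term.\<close>
  have 1: "?F * (1 - fps_X) = Abs_fps (\<lambda>n. if n = 0 then 1 else (1 - c) * q ^ n)"
  proof (rule fps_ext)
    fix n
    show "fps_nth (?F * (1 - fps_X)) n = fps_nth (Abs_fps (\<lambda>n. if n = 0 then 1 else (1 - c) * q ^ n)) n"
      by (cases n) (simp_all add: algebra_simps)
  qed
  \<comment> \<open>The factor 1 - q X kills the geometric sequence from degree 2 on; in degree 1
    there remains (1 - c) q - q = -q c.\<close>
  have "?F * ?D = 1 - fps_const (q * c) * fps_X"
    unfolding mult.assoc[symmetric] 1
  proof (rule fps_ext)
    fix n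
    let ?G = "Abs_fps (\<lambda>n. if n = 0 then 1 else (1 - c) * q ^ n)"
    have "?G * (1 - fps_const q * fps_X) = ?G - fps_const q * (?G * fps_X)"
      by (simp add: algebra_simps)
    then show "fps_nth (?G * (1 - fps_const q * fps_X)) n = fps_nth (1 - fps_const (q * c) * fps_X) n"
      by (cases n; cases "n - 1") (simp_all add: algebra_simps)
  qed
  moreover have "?D \<noteq> 0"
  proof -
    have "fps_nth ?D 0 = 1" by simp
    then show ?thesis by (metis fps_zero_nth zero_neq_one)
  qed
  ultimately show ?thesis by (metis nonzero_mult_div_cancel_right)
qed

theorem corollaryC:
  fixes R :: "('a, 'b) ring_scheme" and P :: "'a set" and q d e :: nat
    and C :: "'c set" and A :: "'c \<Rightarrow> (nat \<times> nat) set" and u :: "'a mat"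
  assumes "compact_discrete_valuation_ring R P"
    and "q = card (carrier (R Quot P))"
    and "d \<ge> 1" and "e \<ge> 1"
    and "partial_colouring d e C A"
    and "u \<in> mats R d e" and "elements_mat u \<subseteq> Units R"
    and "admissible d e C A"
  shows "ask_zeta R P (ARel R d e C A u) =
    (1 - fps_const (of_nat q powi (1 - int d - int e)) * fps_X) /
    ((1 - fps_X) * (1 - fps_const (of_nat q) * fps_X))"
proof -
  interpret compact_discrete_valuation_ring R P by fact
  interpret maximalideal P R by (rule maximalideal_P)
  \<comment> \<open>P is principal, and a generator serves as uniformizer.\<close>
  obtain \<pi> where "\<pi> \<in> carrier R" "P = PIdl\<^bsub>R\<^esub> \<pi>" using exists_gen[OF is_ideal] by blast
  then interpret uniformized_compact_dvr R P \<pi> by unfold_locales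
  have module: "admissible_matrix_module (S n) (red n \<pi>) q n d e C A
      (\<lambda>p. red n (u $$ p)) (map_mat (red n) ` ARel R d e C A u)" for n
    unfolding assms(2) using assms(3,5-8) by (intro admissible_matrix_module_reduced_ARel) auto
  have q: "(of_nat q :: rat) \<noteq> 0" using admissible_matrix_module.q_pos[OF module] by simp
  have "ask_zeta R P (ARel R d e C A u)
      = Abs_fps (\<lambda>n. 1 + (1 - 1 / of_nat q ^ (d + e)) * (\<Sum>m=1..n. of_nat q ^ m))"
    unfolding ask_zeta_def Let_def reduce_mats_def
    by (simp only: admissible_matrix_module.ask_eq[OF module])
  \<comment> \<open>With c = q^(-(d+e)), the coefficient q c of the numerator is the power in the
    claim.\<close>
  moreover have "of_nat q * (1 / of_nat q ^ (d + e)) = (of_nat q powi (1 - int d - int e) :: rat)"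
    using q by (simp add: power_int_diff power_add)
  ultimately show ?thesis by (simp only: fps_eq_rational_function)
qed

end
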